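(* Fix an integer $n\ge2$. For each $d\ge 1$ let $\hat\tau_{n,d}$ be the coupling time of the coupling $\hat c=\hat c_{n,d}$ (defined in the context) started from $\hat X_0=\mathbf 0=(0,\dots,0)$ and $\hat Y_0$ uniformly distributed on $K_n^d$, and let $\tau^*_{n,d}$ be the coupling time of a maximal coupling of the random walks $X,Y$ on $K_n^d$ with the same initial laws. Then $$\liminf_{d\to\infty}\frac{\mathbb E[\hat\tau_{n,d}]}{\mathbb E[\tau^*_{n,d}]}\ \ge\ \frac{n}{n-1}.$$ Consequently, for every fixed $n\geq 2$, the coupling $\hat c_{n,d}$ (with these initial laws) is not a maximal coupling for all sufficiently large $d$.
   Context: Random walk. $K_n$ is the complete graph on vertices $\{0,1,\dots,n-1\}$ and $K_n^d$ is the set of $d$-tuples $(x(1),\dots,x(d))$ with $x(i)\in K_n$. The simple symmetric continuous-time random walk $X$ on $K_n^d$: each coordinate, independently of the others, at the incident times of a unit rate Poisson process jumps to a uniformly chosen value among the $n-1$ values different from its current one. Its equilibrium distribution is uniform on $K_n^d$. Couplings. A coupling of walks $X,Y$ (with given initial laws) is a process $(X^c,Y^c)$ with $X^c\stackrel{\mathcal D}{=}X$, $Y^c\stackrel{\mathcal D}{=}Y$; its coupling time is $\tau^c=\inf\{t: X^c_s=Y^c_s\ \text{for all } s\ge t\}$. One always has the coupling inequality $\|\mathcal L(X_t)-\mathcal L(Y_t)\|_{\mathrm{TV}}\le\mathbb P(\tau^c>t)$. A coupling is maximal if equality holds for all $t\ge0$; a maximal coupling always exists, so $\tau^*_{n,d}$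 has tail $\mathbb P(\tau^*_{n,d}>t)=\|\mathcal L(X_t)-\mathcal L(Y_t)\|_{\mathrm{TV}}$. The coupling $\hat c=(\hat X,\hat Y)$. Let $\hat U_t=\{i:\hat X_t(i)\ne\hat Y_t(i)\}$, $\hat M_t=\{i:\hat X_t(i)=\hat Y_t(i)\}$, $\hat N_t=|\hat U_t|$. For coordinates $i,j\in\{1,\dots,d\}$ and values $k,l\in\{0,\dots,n-1\}$, at rate $\hat q_{(i,k)(j,l)}(t)/(n-1)$ one simultaneously sets $\hat X_t(i)=k$ and $\hat Y_t(j)=l$, all other coordinates being unchanged (either assignment may leave the value unchanged). The non-zero entries of the doubly stochastic matrix $\hat q(t)$ are given as follows, where $2(n-1)/(n-2)$ is read as $+\infty$ if $n=2$: [C1] $\hat q_{(i,k)(i,k)}(t)=1$ for all $i\in\hat M_{t-}$ and all $k$. [C2] If $\hat N_{t-}$ is even or $\hat N_{t-}\ge 2(n-1)/(n-2)$: (i) for $i\neq j$ in $\hat U_{t-}$, $\hat q_{(i,k)(j,l)}(t)=\frac1{\hat N_{t-}-1}$ if $k=\hat Y_{t-}(i)$ and $l=\hat X_{t-}(j)$, and $0$ otherwise; (ii) for $i\in\hat U_{t-}$, $\hat q_{(i,k)(i,k)}(t)=1$ if $k\ne\hat X_{t-}(i)$ and $k\neq\hat Y_{t-}(i)$, and $0$ otherwise; and $\hat q_{(i,\hat X_{t-}(i))(i,\hat Y_{t-}(i))}(t)=1$ for $i\in\hat U_{t-}$ (this causes no change of state). [C3] If $\hat N_{t-}$ is odd and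 $\hat N_{t-}<2(n-1)/(n-2)$: $\hat q_{(i,k)(i,k)}(t)=1$ for all $i\in\hat U_{t-}$ and all $k$. *)

theory Defs
  imports "HOL-Probability.Probability"
begin

(* Vertices of K_n^d: a d-tuple is an extensional function on {..<d}. *)
definition vertices :: "nat \<Rightarrow> nat \<Rightarrow> (nat \<Rightarrow> nat) set" where
  "vertices n d = {..<d} \<rightarrow>\<^sub>E {..<n}"

definition origin :: "nat \<Rightarrow> nat \<Rightarrow> nat" where
  "origin d = (\<lambda>i\<in>{..<d}. 0)"

(* Time is a real parameter of which only the values t >= 0 matter. All paths are
   right-continuous for the discrete topology on S; this makes coupling times measurable. *)
definition process :: "'w measure \<Rightarrow> 's set \<Rightarrow> (real \<Rightarrow> 'w \<Rightarrow> 's) \<Rightarrow> bool" where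
  "process M S X \<longleftrightarrow>
     prob_space M \<and>
     (\<forall>t\<ge>0. X t \<in> M \<rightarrow>\<^sub>M count_space S) \<and>
     (\<forall>\<omega>\<in>space M. \<forall>t\<ge>0. \<forall>\<^sub>F s in at_right t. X s \<omega> = X t \<omega>)"


section \<open>The simple symmetric random walk\<close>

(* Number of points up to time t of the point process with inter-arrival times e 0, e 1, ...
   For unit exponential e this is a unit rate Poisson process; the set is then
   almost surely finite, so the convention that infinite sets have card 0 is irrelevant. *)
definition arrivals :: "(nat \<Rightarrow> real) \<Rightarrow> real \<Rightarrow> nat" where
  "arrivals e t = card {k. (\<Sum>j\<le>k. e j) \<le> t}"

(* Joint law of the starting point and, for the k-th jump of coordinate i, of the pair
   (waiting time, displacement): everything is independent. A displacement is uniform on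
   {1,...,n-1} and is added modulo n, so that the new value of the coordinate is uniform on the
   n-1 values different from the current one. *)
definition driving_law ::
  "nat \<Rightarrow> nat \<Rightarrow> (nat \<Rightarrow> nat) pmf \<Rightarrow> ((nat \<Rightarrow> nat) \<times> (nat \<times> nat \<Rightarrow> real \<times> nat)) measure" where
  "driving_law n d \<mu> =
     measure_pmf \<mu> \<Otimes>\<^sub>M
     (\<Pi>\<^sub>M ik\<in>{..<d} \<times> UNIV.
        density lborel (\<lambda>x. ennreal (exponential_density 1 x)) \<Otimes>\<^sub>M
        measure_pmf (pmf_of_set {1..<n}))"

(* The waiting times e and displacements s are determined up to null sets by the paths of X, so
   this is a property of the law of the process X. *)
definition random_walk ::
  "nat \<Rightarrow> nat \<Rightarrow> (nat \<Rightarrow> nat) pmf \<Rightarrow> 'w measure \<Rightarrow> (real \<Rightarrow> 'w \<Rightarrow> nat \<Rightarrow> nat) \<Rightarrow> bool" where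
  "random_walk n d \<mu> M X \<longleftrightarrow>
     process M (vertices n d) X \<and>
     (\<exists>(e :: nat \<Rightarrow> nat \<Rightarrow> 'w \<Rightarrow> real) (s :: nat \<Rightarrow> nat \<Rightarrow> 'w \<Rightarrow> nat).
        (let D = (\<lambda>\<omega>. (X 0 \<omega>, \<lambda>(i, k)\<in>{..<d} \<times> UNIV. (e i k \<omega>, s i k \<omega>)))
         in D \<in> M \<rightarrow>\<^sub>M driving_law n d \<mu> \<and> distr M (driving_law n d \<mu>) D = driving_law n d \<mu>) \<and>
        (AE \<omega> in M. \<forall>t\<ge>0. \<forall>i<d.
           X t \<omega> i = (X 0 \<omega> i + (\<Sum>k<arrivals (\<lambda>k. e i k \<omega>) t. s i k \<omega>)) mod n))"


section \<open>Couplings\<close>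

definition is_coupling ::
  "nat \<Rightarrow> nat \<Rightarrow> (nat \<Rightarrow> nat) pmf \<Rightarrow> (nat \<Rightarrow> nat) pmf \<Rightarrow> 'w measure \<Rightarrow>
   (real \<Rightarrow> 'w \<Rightarrow> nat \<Rightarrow> nat) \<Rightarrow> (real \<Rightarrow> 'w \<Rightarrow> nat \<Rightarrow> nat) \<Rightarrow> bool" where
  "is_coupling n d \<mu> \<nu> M X Y \<longleftrightarrow> random_walk n d \<mu> M X \<and> random_walk n d \<nu> M Y"

(* Infinite if X and Y never merge. *)
definition coupling_time :: "(real \<Rightarrow> 'w \<Rightarrow> 's) \<Rightarrow> (real \<Rightarrow> 'w \<Rightarrow> 's) \<Rightarrow> 'w \<Rightarrow> ennreal" where
  "coupling_time X Y \<omega> = (INF t\<in>{t. 0 \<le> t \<and> (\<forall>s\<ge>t. X s \<omega> = Y s \<omega>)}. ennreal t)"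

definition tv_dist :: "'s measure \<Rightarrow> 's measure \<Rightarrow> real" where
  "tv_dist P Q = (SUP A\<in>sets P. \<bar>measure P A - measure Q A\<bar>)"

(* Equality in the coupling inequality; S is the state space. *)
definition is_maximal ::
  "'w measure \<Rightarrow> 's set \<Rightarrow> (real \<Rightarrow> 'w \<Rightarrow> 's) \<Rightarrow> (real \<Rightarrow> 'w \<Rightarrow> 's) \<Rightarrow> bool" where
  "is_maximal M S X Y \<longleftrightarrow>
     (\<forall>t\<ge>0. measure M {\<omega> \<in> space M. coupling_time X Y \<omega> > ennreal t} =
            tv_dist (distr M (count_space S) (X t)) (distr M (count_space S) (Y t)))"


section \<open>Markov jump processes with given rates\<close>

(* Transition probabilities on a finite set S whose rate of jumping from x to y is r x y;
   the values of r on the diagonal are irrelevant. *)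
definition transition_semigroup ::
  "'s set \<Rightarrow> ('s \<Rightarrow> 's \<Rightarrow> real) \<Rightarrow> (real \<Rightarrow> 's \<Rightarrow> 's pmf) \<Rightarrow> bool" where
  "transition_semigroup S r p \<longleftrightarrow>
     (\<forall>t\<ge>0. \<forall>x\<in>S. set_pmf (p t x) \<subseteq> S) \<and>
     (\<forall>x\<in>S. p 0 x = return_pmf x) \<and>
     (\<forall>s\<ge>0. \<forall>t\<ge>0. \<forall>x\<in>S. p (s + t) x = bind_pmf (p s x) (p t)) \<and>
     (\<forall>x\<in>S. \<forall>y\<in>S. x \<noteq> y \<longrightarrow> ((\<lambda>h. pmf (p h x) y / h) \<longlongrightarrow> r x y) (at_right 0))"

(* The last conjunct is the Markov property at time u m given the positions at the times u 0, ..., u m,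
   multiplied out to avoid conditioning on null events. *)
definition markov_jump_process ::
  "'s set \<Rightarrow> ('s \<Rightarrow> 's \<Rightarrow> real) \<Rightarrow> 's pmf \<Rightarrow> 'w measure \<Rightarrow> (real \<Rightarrow> 'w \<Rightarrow> 's) \<Rightarrow> bool" where
  "markov_jump_process S r \<mu> M Z \<longleftrightarrow>
     finite S \<and> process M S Z \<and>
     (\<forall>z\<in>S. measure M {\<omega> \<in> space M. Z 0 \<omega> = z} = pmf \<mu> z) \<and>
     (\<exists>p. transition_semigroup S r p \<and>
        (\<forall>(m :: nat) (u :: nat \<Rightarrow> real) z. 0 \<le> u 0 \<longrightarrow> (\<forall>i\<le>m. u i \<le> u (Suc i)) \<longrightarrow>
           (\<forall>i\<le>Suc m. z i \<in> S) \<longrightarrow>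
           measure M {\<omega> \<in> space M. \<forall>i\<le>Suc m. Z (u i) \<omega> = z i} =
           measure M {\<omega> \<in> space M. \<forall>i\<le>m. Z (u i) \<omega> = z i} *
             pmf (p (u (Suc m) - u m) (z m)) (z (Suc m))))"


section \<open>The coupling with rates q-hat\<close>

definition unmatched :: "nat \<Rightarrow> (nat \<Rightarrow> nat) \<Rightarrow> (nat \<Rightarrow> nat) \<Rightarrow> nat set" where
  "unmatched d x y = {i. i < d \<and> x i \<noteq> y i}"

(* The bound 2(n-1)/(n-2) is read as infinity for n = 2. *)
definition paired_regime :: "nat \<Rightarrow> nat \<Rightarrow> bool" where
  "paired_regime n N \<longleftrightarrow>
     even N \<or> (n > 2 \<and> real N \<ge> 2 * (real n - 1) / (real n - 2))"

(* Entry in row (i,k) and column (j,l), when the pair of walks is at (x,y). It belongs to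
   setting coordinate i of the first walk to k and coordinate j of the second walk to l. *)
definition qhat ::
  "nat \<Rightarrow> nat \<Rightarrow> (nat \<Rightarrow> nat) \<Rightarrow> (nat \<Rightarrow> nat) \<Rightarrow> nat \<times> nat \<Rightarrow> nat \<times> nat \<Rightarrow> real" where
  "qhat n d x y = (\<lambda>(i, k) (j, l).
     let U = unmatched d x y; N = card U in
     if i \<in> U \<and> paired_regime n N then
       if j \<in> U \<and> i \<noteq> j then (if k = y i \<and> l = x j then 1 / (real N - 1) else 0)
       else if j = i \<and> l = k then (if k \<noteq> x i \<and> k \<noteq> y i then 1 else 0)
       else if j = i \<and> k = x i \<and> l = y i then 1
       else 0
     else if j = i \<and> l = k then 1
     else 0)"

definition hat_rate ::
  "nat \<Rightarrow> nat \<Rightarrow> (nat \<Rightarrow> nat) \<times> (nat \<Rightarrow> nat) \<Rightarrow> (nat \<Rightarrow> nat) \<times> (nat \<Rightarrow> nat) \<Rightarrow> real" where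
  "hat_rate n d = (\<lambda>(x, y) z.
     \<Sum>(i, k)\<in>{..<d} \<times> {..<n}. \<Sum>(j, l)\<in>{..<d} \<times> {..<n}.
       if (x(i := k), y(j := l)) = z then qhat n d x y (i, k) (j, l) / (real n - 1) else 0)"

definition hat_coupling ::
  "nat \<Rightarrow> nat \<Rightarrow> 'w measure \<Rightarrow>
   (real \<Rightarrow> 'w \<Rightarrow> nat \<Rightarrow> nat) \<Rightarrow> (real \<Rightarrow> 'w \<Rightarrow> nat \<Rightarrow> nat) \<Rightarrow> bool" where
  "hat_coupling n d M X Y \<longleftrightarrow>
     markov_jump_process (vertices n d \<times> vertices n d) (hat_rate n d)
       (map_pmf (\<lambda>y. (origin d, y)) (pmf_of_set (vertices n d)))
       M (\<lambda>t \<omega>. (X t \<omega>, Y t \<omega>))"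

end

theory Submission
  imports Defs "HOL-Real_Asymp.Real_Asymp"
begin

text \<open>The coordinates of the walk started at the origin are independent and relax at rate \<open>n / (n - 1)\<close>, so a
  chi-square estimate bounds the distance to equilibrium at time \<open>(n - 1) / (2 * n) * ln d + k\<close> by a constant
  times \<open>exp (- k)\<close>; hence a maximal coupling needs at most \<open>(n - 1) / (2 * n) * ln d + O(1)\<close> on average. Under the
  coupling with rates q-hat the number \<open>N\<close> of unmatched coordinates has drift \<open>- N * n / (n - 1)\<close> and never
  jumps by more than 2, so \<open>(n - 1) / n * (harm (N + 1) - 1)\<close> decreases at rate at most 1 and its initial mean,
  \<open>(n - 1) / n * ln d - O(1)\<close>, is a lower bound for the mean coupling time. The ratio of the two bounds tends to
  \<open>2 \<ge> n / (n - 1)\<close>.\<close>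


section \<open>The law of the walk at a fixed time\<close>

text \<open>The factor 2 has one source. Put \<open>l = n / (n - 1)\<close>. Under the q-hat
  coupling the mean number of unmatched coordinates is of order \<open>d * exp (- l * t)\<close>,
  and the walks can merge only when this is of order 1. The chi-square distance instead adds up
  squared deviations, \<open>d * exp (- l * t) ^ 2\<close>, and is of order 1 after half that time.
  Two features of the definitions shape the proof. Maximality refers to the laws of the two
  processes at single times, so the last claim needs these laws for the q-hat coupling itself, where
  they are only encoded in the rates. They are recovered from the double stochasticity of q-hat,
  under which products of centred indicators are eigenfunctions of the generator. Moreover, a Markov
  jump process comes with a semigroup of which only right derivatives at time 0 are prescribed, so
  the decay of eigenfunctions and the drift estimate are both carried out on time grids of small
  mesh.\<close>

text \<open>Transition probabilities of a single coordinate in spectral form: the matrix of the jump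
  chain has eigenvalue 1 on constants and \<open>- 1 / (n - 1)\<close> on vectors of sum 0, so at
  unit jump rate the centred part decays at rate \<open>n / (n - 1)\<close>.\<close>

definition coord_kernel :: "nat \<Rightarrow> real \<Rightarrow> nat \<Rightarrow> nat \<Rightarrow> real" where
  "coord_kernel n t a b = 1 / n + exp (- (n / (real n - 1)) * t) * (of_bool (a = b) - 1 / n)"

section \<open>Poisson counts from exponential waiting times\<close>

text \<open>\<open>erlang_CDF k 1 t\<close> is the probability that arrival number
  \<open>k + 1\<close> comes by time \<open>t\<close>; the limit rules out infinitely many arrivals
  by then.\<close>

lemma erlang_CDF_tendsto_0:
  assumes "t \<ge> 0"
  shows "(\<lambda>k. erlang_CDF k 1 t) \<longlonglongrightarrow> 0"
proof -
  have "(\<lambda>k. \<Sum>m<k. t ^ m / fact m) \<longlonglongrightarrow> exp t"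
    using exp_converges[of t] by (simp add: sums_def divide_inverse mult.commute)
  then have "(\<lambda>k. \<Sum>m\<le>k. t ^ m / fact m) \<longlonglongrightarrow> exp t"
    by (subst (asm) filterlim_sequentially_Suc[symmetric]) (simp only: lessThan_Suc_atMost)
  then have "(\<lambda>k. 1 - (\<Sum>m\<le>k. t ^ m / fact m) * exp (- t)) \<longlonglongrightarrow> 1 - exp t * exp (- t)"
    by (intro tendsto_intros)
  moreover have "erlang_CDF k 1 t = 1 - (\<Sum>m\<le>k. t ^ m / fact m) * exp (- t)" for k
    using assms by (simp add: erlang_CDF_def sum_distrib_right)
  ultimately show ?thesis
    by (simp add: exp_minus)
qed

text \<open>With nonnegative waiting times the counted indices form an initial segment, and
  \<open>fin\<close> keeps it finite; an infinite set would have \<open>card\<close> 0. The sum up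
  to index \<open>m - 1\<close> is the time of arrival number \<open>m\<close>, hence the separate
  case \<open>m = 0\<close>.\<close>

lemma arrivals_eq_iff:
  assumes nonneg: "\<And>k. e k \<ge> 0" and fin: "\<exists>k. (\<Sum>j\<le>k. e j) > t"
  shows "arrivals e t = m \<longleftrightarrow> (m = 0 \<or> (\<Sum>j\<le>m - 1. e j) \<le> t) \<and> (\<Sum>j\<le>m. e j) > t"
proof -
  have mono: "(\<Sum>j\<le>k. e j) \<le> (\<Sum>j\<le>l. e j)" if "k \<le> l" for k l
    using that nonneg by (intro sum_mono2) auto
  define l where "l = (LEAST k. (\<Sum>j\<le>k. e j) > t)"
  have l: "(\<Sum>j\<le>l. e j) > t"
    unfolding l_def using fin by (rule LeastI_ex)
  have below: "(\<Sum>j\<le>k. e j) \<le> t" if "k < l" for k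
    using not_less_Least that by (force simp: l_def)
  have "{k. (\<Sum>j\<le>k. e j) \<le> t} = {..<l}"
  proof (intro set_eqI iffI)
    fix k assume "k \<in> {k. (\<Sum>j\<le>k. e j) \<le> t}"
    then show "k \<in> {..<l}"
      using mono[of l k] l by (cases "l \<le> k") auto
  qed (use below in auto)
  then have "arrivals e t = l"
    by (simp add: arrivals_def)
  moreover have "(m = 0 \<or> (\<Sum>j\<le>m - 1. e j) \<le> t) \<and> (\<Sum>j\<le>m. e j) > t \<longleftrightarrow> l = m"
  proof
    assume *: "(m = 0 \<or> (\<Sum>j\<le>m - 1. e j) \<le> t) \<and> (\<Sum>j\<le>m. e j) > t"
    then have "l \<le> m"
      using below not_le by (metis leD)
    moreover have "m \<le> l"
    proof (rule ccontr)
      assume "\<not> m \<le> l"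
      then have "l \<le> m - 1" by simp
      from mono[OF this] show False
        using * l \<open>\<not> m \<le> l\<close> by auto
    qed
    ultimately show "l = m" by simp
  next
    assume "l = m"
    then show "(m = 0 \<or> (\<Sum>j\<le>m - 1. e j) \<le> t) \<and> (\<Sum>j\<le>m. e j) > t"
      using below[of "m - 1"] l by (cases m) auto
  qed
  ultimately show ?thesis by simp
qed

lemma arrivals_measurable [measurable]:
  assumes [measurable]: "\<And>k. e k \<in> borel_measurable M"
  shows "(\<lambda>\<omega>. arrivals (\<lambda>k. e k \<omega>) t) \<in> M \<rightarrow>\<^sub>M count_space UNIV"
  unfolding arrivals_def by measurable

text \<open>For \<open>m > 0\<close> the event of exactly \<open>m\<close> arrivals is the
  difference of two nested events about partial sums, and consecutive Erlang distribution functions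
  differ by a single Poisson term.\<close>

lemma (in prob_space) prob_arrivals:
  fixes e :: "nat \<Rightarrow> 'a \<Rightarrow> real"
  assumes ind: "indep_vars (\<lambda>_. borel) e UNIV"
    and exp: "\<And>k. distributed M lborel (e k) (exponential_density 1)"
    and t: "t \<ge> 0"
  shows "prob {\<omega> \<in> space M. arrivals (\<lambda>k. e k \<omega>) t = m} = t ^ m * exp (- t) / fact m"
proof -
  define S where "S k \<omega> = (\<Sum>j\<le>k. e j \<omega>)" for k \<omega>
  have [measurable]: "e k \<in> borel_measurable M" for k
    using ind by (auto simp: indep_vars_def)
  have [measurable]: "S k \<in> borel_measurable M" for k
    unfolding S_def by measurable
  have S_le: "prob {\<omega> \<in> space M. S k \<omega> \<le> t} = erlang_CDF k 1 t" for k
  proof -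
    have "distributed M lborel (S k) (erlang_density (card {..k} - 1) 1)"
      unfolding S_def using indep_vars_subset[OF ind subset_UNIV]
      by (intro exponential_distributed_sum exp) auto
    then show ?thesis
      using erlang_distributed_le[of "S k" k 1 t] t by simp
  qed
  have nonneg: "AE \<omega> in M. \<forall>k. e k \<omega> \<ge> 0"
  proof (subst AE_all_countable, intro allI)
    fix k
    have "prob {\<omega> \<in> space M. e k \<omega> \<le> 0} = 0"
      using erlang_distributed_le[of "e k" 0 1 0] exp[of k] by (simp add: erlang_CDF_at0)
    then have "AE \<omega> in M. \<not> e k \<omega> \<le> 0"
      by (subst (asm) prob_eq_0) auto
    then show "AE \<omega> in M. e k \<omega> \<ge> 0"
      by eventually_elim auto
  qed
  have unbounded: "AE \<omega> in M. \<exists>k. S k \<omega> > t"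
  proof -
    have "prob {\<omega> \<in> space M. \<forall>k. S k \<omega> \<le> t} \<le> erlang_CDF k 1 t" for k
      unfolding S_le[symmetric] by (intro finite_measure_mono) auto
    then have "prob {\<omega> \<in> space M. \<forall>k. S k \<omega> \<le> t} \<le> 0"
      using LIMSEQ_le_const[OF erlang_CDF_tendsto_0[OF t]] by blast
    then have "prob {\<omega> \<in> space M. \<forall>k. S k \<omega> \<le> t} = 0"
      by (simp add: measure_le_0_iff)
    then have "AE \<omega> in M. \<not> (\<forall>k. S k \<omega> \<le> t)"
      by (subst (asm) prob_eq_0) auto
    then show ?thesis
      by eventually_elim (auto simp: not_le)
  qed
  have "prob {\<omega> \<in> space M. arrivals (\<lambda>k. e k \<omega>) t = m} =
        prob {\<omega> \<in> space M. (m = 0 \<or> S (m - 1) \<omega> \<le> t) \<and> S m \<omega> > t}"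
  proof (rule measure_eq_AE)
    show "AE \<omega> in M. (\<omega> \<in> {\<omega> \<in> space M. arrivals (\<lambda>k. e k \<omega>) t = m}) =
        (\<omega> \<in> {\<omega> \<in> space M. (m = 0 \<or> S (m - 1) \<omega> \<le> t) \<and> S m \<omega> > t})"
      using nonneg unbounded
    proof eventually_elim
      case (elim \<omega>)
      then have "arrivals (\<lambda>k. e k \<omega>) t = m \<longleftrightarrow> (m = 0 \<or> S (m - 1) \<omega> \<le> t) \<and> S m \<omega> > t"
        unfolding S_def by (intro arrivals_eq_iff) blast+
      then show ?case by simp
    qed
  qed measurable
  also have "\<dots> = t ^ m * exp (- t) / fact m"
  proof (cases m)
    case 0
    have "prob {\<omega> \<in> space M. S 0 \<omega> > t} = 1 - prob {\<omega> \<in> space M. S 0 \<omega> \<le> t}"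
      by (subst prob_compl[symmetric]) (auto intro!: arg_cong[where f = prob])
    then show ?thesis
      using 0 t by (simp add: S_le) (simp add: erlang_CDF_def)
  next
    case (Suc k)
    have "AE \<omega> in M. S k \<omega> \<le> S m \<omega>"
      using nonneg by eventually_elim (simp add: S_def Suc)
    then have "prob {\<omega> \<in> space M. S m \<omega> \<le> t} = prob {\<omega> \<in> space M. S k \<omega> \<le> t \<and> S m \<omega> \<le> t}"
      by (intro measure_eq_AE) auto
    moreover have "prob {\<omega> \<in> space M. S k \<omega> \<le> t \<and> S m \<omega> > t} =
        prob {\<omega> \<in> space M. S k \<omega> \<le> t} - prob {\<omega> \<in> space M. S k \<omega> \<le> t \<and> S m \<omega> \<le> t}"
      by (subst finite_measure_Diff[symmetric]) (auto intro!: arg_cong[where f = prob])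
    ultimately show ?thesis
      using Suc t by (simp add: S_le) (simp add: erlang_CDF_def)
  qed
  finally show ?thesis .
qed

section \<open>Sums of uniform displacements modulo n\<close>

text \<open>\<open>n - a\<close> acts as the inverse of \<open>a\<close> modulo \<open>n\<close>;
  subtracting \<open>a\<close> from \<open>b\<close> directly could truncate at 0.\<close>

lemma add_mod_eq_iff:
  fixes a b c n :: nat
  assumes "a < n" "b < n" "c < n"
  shows "(a + c) mod n = b \<longleftrightarrow> c = (b + (n - a)) mod n"
proof (cases "a \<le> b")
  case True
  then have "(b + (n - a)) mod n = b - a"
    using assms by (simp add: mod_if)
  then show ?thesis
    using assms True by (auto simp: mod_if)
next
  case False
  then have "(b + (n - a)) mod n = b + (n - a)"
    using assms by (simp add: mod_if)
  then show ?thesis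
    using assms False by (auto simp: mod_if)
qed

text \<open>A jump never stays put and is uniform on the other values, so the probability
  \<open>p m\<close> of sitting at \<open>b\<close> after \<open>m\<close> jumps satisfies
  \<open>p (m + 1) = (1 - p m) / (n - 1)\<close>. This affine recursion has fixed point
  \<open>1 / n\<close> and slope \<open>- 1 / (n - 1)\<close>.\<close>

lemma (in prob_space) prob_displacement_sum:
  fixes s :: "nat \<Rightarrow> 'a \<Rightarrow> nat"
  assumes ind: "indep_vars (\<lambda>_. count_space UNIV) s UNIV"
    and unif: "\<And>k c. c \<in> {1..<n} \<Longrightarrow> prob {\<omega> \<in> space M. s k \<omega> = c} = 1 / (real n - 1)"
    and n: "n \<ge> 2" and ab: "a < n" "b < n"
  shows "prob {\<omega> \<in> space M. (a + (\<Sum>k<m. s k \<omega>)) mod n = b} =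
    1 / n + (- 1 / (real n - 1)) ^ m * (of_bool (a = b) - 1 / n)"
  using ab(2)
proof (induction m arbitrary: b)
  case 0
  then show ?case
    using ab by (auto simp: prob_space)
next
  case (Suc m)
  have [measurable]: "s k \<in> M \<rightarrow>\<^sub>M count_space UNIV" for k
    using ind by (auto simp: indep_vars_def)
  define R where "R \<omega> = (a + (\<Sum>k<m. s k \<omega>)) mod n" for \<omega>
  have [measurable]: "R \<in> M \<rightarrow>\<^sub>M count_space UNIV"
    unfolding R_def by measurable
  have indep: "prob {\<omega> \<in> space M. R \<omega> = r \<and> s m \<omega> = c} =
      prob {\<omega> \<in> space M. R \<omega> = r} * prob {\<omega> \<in> space M. s m \<omega> = c}" for r c
  proof -
    have "indep_var (count_space UNIV) ((\<lambda>f. (a + (\<Sum>k<m. f k)) mod n) \<circ> (\<lambda>\<omega>. restrict (\<lambda>k. s k \<omega>) {..<m}))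
            (count_space UNIV) ((\<lambda>f. f m) \<circ> (\<lambda>\<omega>. restrict (\<lambda>k. s k \<omega>) {m}))"
      by (intro indep_var_compose[OF indep_var_restrict[OF ind]]) auto
    from indep_varD[OF this, of "{r}" "{c}"] show ?thesis
      by (simp add: R_def vimage_def Int_def conj_commute cong: sum.cong_simp)
  qed
  have s_AE: "AE \<omega> in M. s m \<omega> \<in> {1..<n}"
  proof -
    have "prob {\<omega> \<in> space M. s m \<omega> \<in> {1..<n}} = (\<Sum>c\<in>{1..<n}. prob {\<omega> \<in> space M. s m \<omega> = c})"
      by (subst finite_measure_finite_Union[symmetric])
        (auto simp: disjoint_family_on_def intro!: arg_cong[where f = prob])
    also have "\<dots> = (\<Sum>c\<in>{1..<n}. 1 / (real n - 1))"
      using unif by simp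
    also have "\<dots> = 1"
      using n by (simp add: of_nat_diff)
    finally show ?thesis
      by (subst (asm) prob_eq_1) auto
  qed
  \<comment> \<open>Given the position \<open>r\<close> before the last jump, a single displacement
    leads to \<open>b\<close>; it is nonzero precisely when \<open>r\<close> differs from
    \<open>b\<close>.\<close>
  have "prob {\<omega> \<in> space M. (a + (\<Sum>k<Suc m. s k \<omega>)) mod n = b} =
        prob (\<Union>r\<in>{..<n} - {b}. {\<omega> \<in> space M. R \<omega> = r \<and> s m \<omega> = (b + (n - r)) mod n})"
  proof (rule measure_eq_AE)
    show "AE \<omega> in M. (\<omega> \<in> {\<omega> \<in> space M. (a + (\<Sum>k<Suc m. s k \<omega>)) mod n = b}) =
        (\<omega> \<in> (\<Union>r\<in>{..<n} - {b}. {\<omega> \<in> space M. R \<omega> = r \<and> s m \<omega> = (b + (n - r)) mod n}))"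
      using s_AE
    proof eventually_elim
      case (elim \<omega>)
      have R: "R \<omega> < n"
        using n by (simp add: R_def)
      have "(a + (\<Sum>k<Suc m. s k \<omega>)) mod n = (R \<omega> + s m \<omega>) mod n"
        by (simp add: R_def mod_simps ac_simps)
      moreover have "(R \<omega> + s m \<omega>) mod n = b \<longleftrightarrow> s m \<omega> = (b + (n - R \<omega>)) mod n"
        using elim R Suc.prems by (intro add_mod_eq_iff) auto
      moreover have "s m \<omega> = (b + (n - R \<omega>)) mod n \<Longrightarrow> R \<omega> \<noteq> b"
        using elim R by auto
      ultimately show ?case
        using R by auto
    qed
  qed auto
  also have "\<dots> = (\<Sum>r\<in>{..<n} - {b}. prob {\<omega> \<in> space M. R \<omega> = r \<and> s m \<omega> = (b + (n - r)) mod n})"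
    by (intro finite_measure_finite_Union) (auto simp: disjoint_family_on_def)
  also have "\<dots> = (\<Sum>r\<in>{..<n} - {b}. prob {\<omega> \<in> space M. R \<omega> = r} * (1 / (real n - 1)))"
  proof (rule sum.cong[OF refl])
    fix r assume r: "r \<in> {..<n} - {b}"
    have "(b + (n - r)) mod n \<noteq> 0"
      using r Suc.prems add_mod_eq_iff[of r n b 0] by auto
    moreover have "(b + (n - r)) mod n < n"
      using n by simp
    ultimately have "(b + (n - r)) mod n \<in> {1..<n}"
      by (metis atLeastLessThan_iff less_one not_le)
    then show "prob {\<omega> \<in> space M. R \<omega> = r \<and> s m \<omega> = (b + (n - r)) mod n} = prob {\<omega> \<in> space M. R \<omega> = r} * (1 / (real n - 1))"
      using unif by (simp only: indep)
  qed
  also have "\<dots> = (\<Sum>r\<in>{..<n} - {b}. prob {\<omega> \<in> space M. R \<omega> = r}) * (1 / (real n - 1))"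
    by (simp only: sum_distrib_right)
  also have "(\<Sum>r\<in>{..<n} - {b}. prob {\<omega> \<in> space M. R \<omega> = r}) =
      (\<Sum>r<n. prob {\<omega> \<in> space M. R \<omega> = r}) - prob {\<omega> \<in> space M. R \<omega> = b}"
    using Suc.prems by (subst sum_diff1) auto
  also have "(\<Sum>r<n. prob {\<omega> \<in> space M. R \<omega> = r}) = prob (\<Union>r\<in>{..<n}. {\<omega> \<in> space M. R \<omega> = r})"
    by (intro finite_measure_finite_Union[symmetric]) (auto simp: disjoint_family_on_def)
  also have "(\<Union>r\<in>{..<n}. {\<omega> \<in> space M. R \<omega> = r}) = space M"
    using n by (auto simp: R_def)
  also have "prob {\<omega> \<in> space M. R \<omega> = b} =
      1 / n + (- 1 / (real n - 1)) ^ m * (of_bool (a = b) - 1 / n)"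
    unfolding R_def by (rule Suc.IH[OF Suc.prems])
  also have "prob (space M) = 1"
    by (rule prob_space)
  also have "(1 - (1 / n + (- 1 / (real n - 1)) ^ m * (of_bool (a = b) - 1 / n))) * (1 / (real n - 1)) =
      1 / n + (- 1 / (real n - 1)) ^ Suc m * (of_bool (a = b) - 1 / n)"
  proof -
    define q g :: real where "q = (- 1 / (real n - 1)) ^ m" and "g = of_bool (a = b) - 1 / n"
    have "(1 - (1 / n + q * g)) * (1 / (real n - 1)) = (1 - 1 / n) / (real n - 1) + (- 1 / (real n - 1)) * q * g"
      by (simp add: algebra_simps add_divide_distrib diff_divide_distrib)
    also have "(1 - 1 / real n) / (real n - 1) = 1 / n"
      using n by (simp add: divide_simps)
    finally show ?thesis
      by (simp only: q_def g_def power_Suc)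
  qed
  finally show ?case .
qed

section \<open>Independent families on a product space\<close>

text \<open>Waiting times and displacements of all jumps have to form one independent family, so
  that functions of disjoint groups of them are independent. A finite subfamily is handled by
  turning its events into a box with one rectangle per pair.\<close>

lemma indep_vars_PiM_pair:
  fixes f :: "'a \<Rightarrow> real" and g :: "'b \<Rightarrow> real" and I :: "'i set"
  assumes "prob_space A" "prob_space B"
    and [measurable]: "f \<in> borel_measurable A" "g \<in> borel_measurable B"
  shows "prob_space.indep_vars (\<Pi>\<^sub>M p\<in>I. A \<Otimes>\<^sub>M B) (\<lambda>_. borel)
    (\<lambda>(p, b) \<omega>. if b then f (fst (\<omega> p)) else g (snd (\<omega> p))) (I \<times> UNIV)"
proof -
  interpret A: prob_space A by fact
  interpret B: prob_space B by fact
  interpret AB: pair_prob_space A B ..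
  interpret product_prob_space "\<lambda>_ :: 'i. A \<Otimes>\<^sub>M B" I ..
  define P where "P = (\<Pi>\<^sub>M p\<in>I. A \<Otimes>\<^sub>M B)"
  interpret Q: prob_space P unfolding P_def by (rule prob_space_axioms)
  define V where "V = (\<lambda>(p :: 'i, b) \<omega>. if b then f (fst (\<omega> p)) else g (snd (\<omega> p)))"
  have V_measurable: "V j \<in> borel_measurable P" if "j \<in> I \<times> UNIV" for j
    using that unfolding V_def P_def by (cases j) auto
  define \<mu> where "\<mu> j C = (if snd j then measure A (f -` C \<inter> space A) else measure B (g -` C \<inter> space B))"
    for j :: "'i \<times> bool" and C
  have box: "Q.prob (\<Inter>j\<in>J. V j -` C j \<inter> space P) = (\<Prod>j\<in>J. \<mu> j (C j))"
    if J: "J \<noteq> {}" "J \<subseteq> I \<times> UNIV" "finite J" and C: "\<And>j. j \<in> J \<Longrightarrow> C j \<in> sets borel" for J C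
  proof -
    \<comment> \<open>Padding with \<open>UNIV\<close>: a pair of which only one component occurs in
      \<open>J\<close> still yields a full rectangle, and the padded component contributes the
      factor 1.\<close>
    define C' where "C' j = (if j \<in> J then C j else UNIV)" for j
    have [measurable]: "C' j \<in> sets borel" for j
      using C by (simp add: C'_def)
    define K where "K = fst ` J"
    have K: "K \<subseteq> I" "finite K"
      using J by (auto simp: K_def)
    define R where "R p = (f -` C' (p, True) \<inter> space A) \<times> (g -` C' (p, False) \<inter> space B)" for p
    have R: "R p \<in> sets (A \<Otimes>\<^sub>M B)" for p
      unfolding R_def by measurable
    have "(\<Inter>j\<in>J. V j -` C j \<inter> space P) = prod_emb I (\<lambda>_. A \<Otimes>\<^sub>M B) K (Pi\<^sub>E K R)"
    proof (intro set_eqI iffI)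
      fix \<omega> assume *: "\<omega> \<in> (\<Inter>j\<in>J. V j -` C j \<inter> space P)"
      then have space: "\<omega> \<in> space P" using J by auto
      have "\<omega> p \<in> R p" if "p \<in> K" for p
      proof -
        have "\<omega> p \<in> space A \<times> space B"
          using space that K by (auto simp: P_def space_PiM space_pair_measure PiE_iff)
        moreover have "V (p, b) \<omega> \<in> C' (p, b)" for b
          using * J(1) by (auto simp: C'_def)
        from this[of True] this[of False] have "f (fst (\<omega> p)) \<in> C' (p, True)" "g (snd (\<omega> p)) \<in> C' (p, False)"
          by (auto simp: V_def)
        ultimately show ?thesis
          by (cases "\<omega> p") (auto simp: R_def)
      qed
      then show "\<omega> \<in> prod_emb I (\<lambda>_. A \<Otimes>\<^sub>M B) K (Pi\<^sub>E K R)"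
        using space by (auto simp: P_def prod_emb_def space_PiM)
    next
      fix \<omega> assume *: "\<omega> \<in> prod_emb I (\<lambda>_. A \<Otimes>\<^sub>M B) K (Pi\<^sub>E K R)"
      then have space: "\<omega> \<in> space P"
        by (auto simp: prod_emb_def P_def space_PiM)
      have "V j \<omega> \<in> C j" if "j \<in> J" for j
      proof -
        obtain p b where j: "j = (p, b)" by (cases j)
        have p: "p \<in> K" using that j by (force simp: K_def)
        then have "restrict \<omega> K p \<in> R p"
          using * unfolding prod_emb_def by blast
        then have "\<omega> p \<in> R p"
          using p by simp
        then show ?thesis
          using that by (cases "\<omega> p"; cases b) (auto simp: j V_def R_def C'_def)
      qed
      then show "\<omega> \<in> (\<Inter>j\<in>J. V j -` C j \<inter> space P)"
        using space by auto
    qed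
    then have "Q.prob (\<Inter>j\<in>J. V j -` C j \<inter> space P) = (\<Prod>p\<in>K. measure (A \<Otimes>\<^sub>M B) (R p))"
      unfolding P_def using measure_PiM_emb[OF K, of R] R by simp
    also have "\<dots> = (\<Prod>p\<in>K. \<Prod>b\<in>UNIV. \<mu> (p, b) (C' (p, b)))"
    proof (rule prod.cong[OF refl])
      fix p
      have "f -` C' (p, True) \<inter> space A \<in> sets A" "g -` C' (p, False) \<inter> space B \<in> sets B"
        by measurable
      then have "measure (A \<Otimes>\<^sub>M B) (R p) = \<mu> (p, True) (C' (p, True)) * \<mu> (p, False) (C' (p, False))"
        unfolding R_def \<mu>_def by (simp add: measure_def B.emeasure_pair_measure_Times enn2real_mult)
      then show "measure (A \<Otimes>\<^sub>M B) (R p) = (\<Prod>b\<in>UNIV. \<mu> (p, b) (C' (p, b)))"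
        by (simp add: UNIV_bool)
    qed
    also have "\<dots> = (\<Prod>j\<in>K \<times> UNIV. \<mu> j (C' j))"
      by (simp add: prod.cartesian_product)
    also have "\<dots> = (\<Prod>j\<in>J. \<mu> j (C' j))"
    proof (rule prod.mono_neutral_right)
      show "J \<subseteq> K \<times> UNIV" by (force simp: K_def)
      show "\<forall>j\<in>K \<times> UNIV - J. \<mu> j (C' j) = 1"
        by (auto simp: \<mu>_def C'_def A.prob_space B.prob_space)
    qed (use K in auto)
    finally show ?thesis
      by (simp add: C'_def)
  qed
  have "Q.indep_vars (\<lambda>_. borel) V (I \<times> UNIV)"
    unfolding Q.indep_vars_def2
  proof (intro conjI ballI Q.indep_setsI)
    fix A' J assume J: "J \<noteq> {}" "J \<subseteq> I \<times> (UNIV :: bool set)" "finite J"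
      and "\<forall>j\<in>J. A' j \<in> {V j -` C \<inter> space P |C. C \<in> sets borel}"
    then have "\<forall>j\<in>J. \<exists>C. A' j = V j -` C \<inter> space P \<and> C \<in> sets borel"
      by blast
    then obtain C where C: "\<And>j. j \<in> J \<Longrightarrow> A' j = V j -` C j \<inter> space P" "\<And>j. j \<in> J \<Longrightarrow> C j \<in> sets borel"
      by metis
    have "Q.prob (A' j) = \<mu> j (C j)" if "j \<in> J" for j
      using box[of "{j}" C] that J C by auto
    moreover have "Q.prob (\<Inter>j\<in>J. A' j) = (\<Prod>j\<in>J. \<mu> j (C j))"
      using box[OF J, of C] C by simp
    ultimately show "Q.prob (\<Inter>j\<in>J. A' j) = (\<Prod>j\<in>J. Q.prob (A' j))"
      by simp
  qed (use V_measurable in \<open>auto intro!: measurable_sets\<close>)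
  then show ?thesis
    by (simp add: V_def P_def)
qed

text \<open>Reindexing along an injection is grouping into the disjoint singletons
  \<open>{h l}\<close>.\<close>

lemma (in prob_space) indep_vars_reindex:
  assumes "indep_vars M' X I" and h: "inj_on h L" "h ` L \<subseteq> I"
  shows "indep_vars (\<lambda>l. M' (h l)) (\<lambda>l. X (h l)) L"
proof -
  have "indep_vars (\<lambda>l. M' (h l)) (\<lambda>l \<omega>. (\<lambda>f. f (h l)) (restrict (\<lambda>i. X i \<omega>) {h l})) L"
  proof (rule indep_vars_compose2[OF indep_vars_restrict[OF assms(1)]])
    show "disjoint_family_on (\<lambda>l. {h l}) L"
      using h(1) by (auto simp: disjoint_family_on_def inj_on_def)
  qed (use h in auto)
  then show ?thesis by simp
qed

text \<open>Displacements are carried as reals, so that they form a single family with the waiting times.\<close>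

lemma (in prob_space) prob_coordinate:
  fixes W :: "nat \<times> bool \<Rightarrow> 'a \<Rightarrow> real"
  assumes ind: "indep_vars (\<lambda>_. borel) W UNIV"
    and exp: "\<And>k. distributed M lborel (W (k, True)) (exponential_density 1)"
    and unif: "\<And>k c. c \<in> {1..<n} \<Longrightarrow> prob {\<omega> \<in> space M. nat \<lfloor>W (k, False) \<omega>\<rfloor> = c} = 1 / (real n - 1)"
    and n: "n \<ge> 2" and ab: "a < n" "b < n" and t: "t \<ge> 0"
  shows "prob {\<omega> \<in> space M.
      (a + (\<Sum>k<arrivals (\<lambda>k. W (k, True) \<omega>) t. nat \<lfloor>W (k, False) \<omega>\<rfloor>)) mod n = b} = coord_kernel n t a b"
proof -
  have W_measurable [measurable]: "W j \<in> borel_measurable M" for j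
    using ind unfolding indep_vars_def by blast
  define s where "s k \<omega> = nat \<lfloor>W (k, False) \<omega>\<rfloor>" for k \<omega>
  define N where "N \<omega> = arrivals (\<lambda>k. W (k, True) \<omega>) t" for \<omega>
  have [measurable]: "s k \<in> M \<rightarrow>\<^sub>M count_space UNIV" for k
    unfolding s_def by measurable
  have [measurable]: "N \<in> M \<rightarrow>\<^sub>M count_space UNIV"
    unfolding N_def by measurable
  have ind_e: "indep_vars (\<lambda>_. borel) (\<lambda>k. W (k, True)) UNIV"
    by (rule indep_vars_reindex[OF ind]) (auto simp: inj_on_def)
  have "indep_vars (\<lambda>_. borel) (\<lambda>k. W (k, False)) UNIV"
    by (rule indep_vars_reindex[OF ind]) (auto simp: inj_on_def)
  then have "indep_vars (\<lambda>_. count_space UNIV) (\<lambda>k \<omega>. (\<lambda>x. nat \<lfloor>x\<rfloor>) (W (k, False) \<omega>)) UNIV"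
    by (rule indep_vars_compose2) auto
  then have ind_s: "indep_vars (\<lambda>_. count_space UNIV) s UNIV"
    by (simp add: s_def[abs_def])
  \<comment> \<open>For a fixed number \<open>m\<close> of jumps the final value depends on the
    displacements alone, and the event of \<open>m\<close> arrivals on the waiting times
    alone.\<close>
  have split: "prob {\<omega> \<in> space M. N \<omega> = m \<and> (a + (\<Sum>k<m. s k \<omega>)) mod n = b} =
      t ^ m * exp (- t) / fact m * (1 / n + (- 1 / (real n - 1)) ^ m * (of_bool (a = b) - 1 / n))" for m
  proof -
    let ?E = "UNIV \<times> {True} :: (nat \<times> bool) set" and ?D = "UNIV \<times> {False} :: (nat \<times> bool) set"
    have "indep_var
        (count_space UNIV) ((\<lambda>f. arrivals (\<lambda>k. f (k, True)) t) \<circ> (\<lambda>\<omega>. restrict (\<lambda>j. W j \<omega>) ?E))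
        (count_space UNIV) ((\<lambda>f. (a + (\<Sum>k<m. nat \<lfloor>f (k, False)\<rfloor>)) mod n) \<circ> (\<lambda>\<omega>. restrict (\<lambda>j. W j \<omega>) ?D))"
      by (intro indep_var_compose[OF indep_var_restrict[OF ind]]) auto
    from indep_varD[OF this, of "{m}" "{b}"]
    have "prob {\<omega> \<in> space M. N \<omega> = m \<and> (a + (\<Sum>k<m. s k \<omega>)) mod n = b} =
        prob {\<omega> \<in> space M. N \<omega> = m} * prob {\<omega> \<in> space M. (a + (\<Sum>k<m. s k \<omega>)) mod n = b}"
      by (simp add: N_def s_def vimage_def Int_def conj_commute)
    also have "prob {\<omega> \<in> space M. N \<omega> = m} = t ^ m * exp (- t) / fact m"
      unfolding N_def by (rule prob_arrivals[OF ind_e exp t])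
    also have "prob {\<omega> \<in> space M. (a + (\<Sum>k<m. s k \<omega>)) mod n = b} =
        1 / n + (- 1 / (real n - 1)) ^ m * (of_bool (a = b) - 1 / n)"
      by (rule prob_displacement_sum[OF ind_s _ n ab]) (simp add: s_def unif)
    finally show ?thesis .
  qed
  have "(\<lambda>m. prob {\<omega> \<in> space M. N \<omega> = m \<and> (a + (\<Sum>k<m. s k \<omega>)) mod n = b}) sums
      prob (\<Union>m. {\<omega> \<in> space M. N \<omega> = m \<and> (a + (\<Sum>k<m. s k \<omega>)) mod n = b})"
    by (intro finite_measure_UNION) (auto simp: disjoint_family_on_def)
  also have "(\<Union>m. {\<omega> \<in> space M. N \<omega> = m \<and> (a + (\<Sum>k<m. s k \<omega>)) mod n = b}) =
      {\<omega> \<in> space M. (a + (\<Sum>k<N \<omega>. s k \<omega>)) mod n = b}"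
    by auto
  finally have sums: "(\<lambda>m. t ^ m * exp (- t) / fact m *
        (1 / n + (- 1 / (real n - 1)) ^ m * (of_bool (a = b) - 1 / n))) sums
      prob {\<omega> \<in> space M. (a + (\<Sum>k<N \<omega>. s k \<omega>)) mod n = b}"
    by (simp only: split)
  \<comment> \<open>Averaging \<open>q ^ m\<close> over the Poisson number of jumps gives
    \<open>exp (q * t - t)\<close>, and \<open>1 - q = n / (n - 1)\<close>.\<close>
  define q :: real where "q = - 1 / (real n - 1)"
  have "(\<lambda>m. exp (- t) * (1 / n) * (t ^ m /\<^sub>R fact m) +
        exp (- t) * (of_bool (a = b) - 1 / n) * ((q * t) ^ m /\<^sub>R fact m)) sums
      (exp (- t) * (1 / n) * exp t + exp (- t) * (of_bool (a = b) - 1 / n) * exp (q * t))"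
    by (intro sums_add sums_mult exp_converges)
  moreover have "exp (- t) * (1 / n) * (t ^ m /\<^sub>R fact m) +
        exp (- t) * (of_bool (a = b) - 1 / n) * ((q * t) ^ m /\<^sub>R fact m) =
      t ^ m * exp (- t) / fact m * (1 / n + q ^ m * (of_bool (a = b) - 1 / n))" for m
    by (simp add: divide_inverse power_mult_distrib distrib_left mult_ac)
  ultimately have "prob {\<omega> \<in> space M. (a + (\<Sum>k<N \<omega>. s k \<omega>)) mod n = b} =
      exp (- t) * (1 / n) * exp t + exp (- t) * (of_bool (a = b) - 1 / n) * exp (q * t)"
    using sums by (simp only: q_def[symmetric]) (rule sums_unique2)
  also have "\<dots> = 1 / n + exp (- t + q * t) * (of_bool (a = b) - 1 / n)"
    by (simp only: exp_add) (simp add: exp_minus)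
  also have "- t + q * t = - (n / (real n - 1)) * t"
    using n by (simp add: q_def field_simps)
  finally show ?thesis
    by (simp add: coord_kernel_def N_def s_def)
qed

section \<open>Joint law of all coordinates at a fixed time\<close>

lemma coordinate_in_vertices: "x \<in> vertices n d \<Longrightarrow> i < d \<Longrightarrow> x i < n"
  by (auto simp: vertices_def)

lemma finite_vertices [simp]: "finite (vertices n d)"
  by (auto simp: vertices_def intro!: finite_PiE)

lemma vertices_eqI: "x \<in> vertices n d \<Longrightarrow> y \<in> vertices n d \<Longrightarrow> (\<And>i. i < d \<Longrightarrow> x i = y i) \<Longrightarrow> x = y"
  unfolding vertices_def by (rule PiE_ext) auto

abbreviation jump_law :: "nat \<Rightarrow> (real \<times> nat) measure" where
  "jump_law n \<equiv> density lborel (\<lambda>x. ennreal (exponential_density 1 x)) \<Otimes>\<^sub>M measure_pmf (pmf_of_set {1..<n})"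

lemma
  fixes n d :: nat and a b :: "nat \<Rightarrow> nat" and t :: real
  assumes n: "n \<ge> 2" and d: "d \<ge> 1" and t: "t \<ge> 0"
    and ab: "\<And>i. i < d \<Longrightarrow> a i < n" "\<And>i. i < d \<Longrightarrow> b i < n"
  defines "P \<equiv> \<Pi>\<^sub>M ik\<in>{..<d} \<times> UNIV. jump_law n"
  defines "E \<equiv> {g \<in> space P. \<forall>i<d. (a i + (\<Sum>k<arrivals (\<lambda>k. fst (g (i, k))) t. snd (g (i, k)))) mod n = b i}"
  shows sets_displaced: "E \<in> sets P"
    and measure_displaced: "measure P E = (\<Prod>i<d. coord_kernel n t (a i) (b i))"
proof -
  let ?A = "density lborel (\<lambda>x. ennreal (exponential_density 1 x))"
  let ?B = "measure_pmf (pmf_of_set {1..<n})"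
  let ?I = "{..<d} \<times> (UNIV :: nat set)"
  have A: "prob_space ?A"
    by (rule prob_space_exponential_density) simp
  have B: "prob_space ?B"
    by (rule measure_pmf.prob_space_axioms)
  interpret A: prob_space ?A by (rule A)
  interpret B: prob_space ?B by (rule B)
  interpret AB: pair_prob_space ?A ?B ..
  interpret P: prob_space P
    unfolding P_def by (intro prob_space_PiM AB.prob_space_axioms)
  define V :: "(nat \<times> nat) \<times> bool \<Rightarrow> (nat \<times> nat \<Rightarrow> real \<times> nat) \<Rightarrow> real"
    where "V = (\<lambda>(p, b) g. if b then fst (g p) else real (snd (g p)))"
  have ind: "P.indep_vars (\<lambda>_. borel) V (?I \<times> UNIV)"
    unfolding V_def P_def using indep_vars_PiM_pair[OF A B, of "\<lambda>x. x" real ?I] by simp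
  have component: "distr P (jump_law n) (\<lambda>g. g p) = jump_law n" if "p \<in> ?I" for p
    unfolding P_def by (intro distr_PiM_component AB.prob_space_axioms that)
  have component_measurable: "(\<lambda>g. g p) \<in> P \<rightarrow>\<^sub>M jump_law n" if "p \<in> ?I" for p
    unfolding P_def using that by (rule measurable_component_singleton)
  have exp: "distributed P lborel (V (p, True)) (exponential_density 1)" if p: "p \<in> ?I" for p
  proof -
    have "distr P ?A (\<lambda>g. fst (g p)) = distr (distr P (jump_law n) (\<lambda>g. g p)) ?A fst"
      by (subst distr_distr[OF measurable_fst component_measurable[OF p]]) (simp only: comp_def)
    also have "\<dots> = ?A"
      by (simp only: component[OF p] measure_pmf.distr_pair_fst)
    finally have "distr P ?A (\<lambda>g. fst (g p)) = ?A" .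
    moreover have "distr P lborel (\<lambda>g. fst (g p)) = distr P ?A (\<lambda>g. fst (g p))"
      by (intro distr_cong) auto
    moreover have "V (p, True) = (\<lambda>g. fst (g p))"
      by (simp add: V_def fun_eq_iff)
    moreover have "(\<lambda>g. fst (g p)) \<in> P \<rightarrow>\<^sub>M ?A"
      by (rule measurable_compose[OF component_measurable[OF p] measurable_fst])
    ultimately show ?thesis
      unfolding distributed_def by simp
  qed
  have unif: "P.prob {g \<in> space P. nat \<lfloor>V (p, False) g\<rfloor> = c} = 1 / (real n - 1)"
    if p: "p \<in> ?I" and c: "c \<in> {1..<n}" for p c
  proof -
    have "P.prob {g \<in> space P. nat \<lfloor>V (p, False) g\<rfloor> = c} = measure (distr P (jump_law n) (\<lambda>g. g p)) (space ?A \<times> {c})"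
      using p by (subst measure_distr[OF component_measurable])
        (auto simp: V_def mem_Times_iff intro!: arg_cong2[where f = measure])
    also have "\<dots> = measure (jump_law n) (space ?A \<times> {c})"
      by (simp only: component[OF p])
    also have "\<dots> = pmf (pmf_of_set {1..<n}) c"
      using measure_pmf.emeasure_pair_measure_Times[of "space ?A" ?A "{c}"]
      by (simp only: measure_def A.emeasure_space_1)
        (simp add: measure_def[symmetric] measure_pmf_single)
    also have "\<dots> = 1 / (real n - 1)"
      using c n by (simp add: of_nat_diff)
    finally show ?thesis .
  qed
  define J :: "nat \<Rightarrow> ((nat \<times> nat) \<times> bool) set" where "J i = ({i} \<times> UNIV) \<times> UNIV" for i
  define F where "F i f = (a i + (\<Sum>k<arrivals (\<lambda>k. f ((i, k), True)) t. nat \<lfloor>f ((i, k), False)\<rfloor>)) mod n"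
    for i and f :: "(nat \<times> nat) \<times> bool \<Rightarrow> real"
  \<comment> \<open>Restricting \<open>V\<close> to the block \<open>J i\<close> exhibits
    \<open>C i\<close> as a function of that block; blocks of different coordinates are
    disjoint.\<close>
  define C where "C i g = F i (\<lambda>j\<in>J i. V j g)" for i g
  have C_eq: "C i g = (a i + (\<Sum>k<arrivals (\<lambda>k. fst (g (i, k))) t. snd (g (i, k)))) mod n" for i g
    by (simp add: C_def F_def J_def V_def)
  have F_measurable: "F i \<in> Pi\<^sub>M (J i) (\<lambda>_. borel) \<rightarrow>\<^sub>M count_space UNIV" for i
  proof -
    have [measurable]: "(\<lambda>f. f ((i, k), b) :: real) \<in> borel_measurable (Pi\<^sub>M (J i) (\<lambda>_. borel))" for k b
      by (rule measurable_component_singleton) (simp add: J_def)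
    have [measurable]: "(\<lambda>f. (a i + (\<Sum>k<m. nat \<lfloor>f ((i, k), False) :: real\<rfloor>)) mod n)
        \<in> Pi\<^sub>M (J i) (\<lambda>_. borel) \<rightarrow>\<^sub>M count_space UNIV" for m
      by measurable
    \<comment> \<open>The number of summands is itself random, so measurability is checked
      separately for each of its countably many values.\<close>
    have "(\<lambda>f. arrivals (\<lambda>k. f ((i, k), True)) t) \<in> Pi\<^sub>M (J i) (\<lambda>_. borel) \<rightarrow>\<^sub>M count_space UNIV"
      by measurable
    then show ?thesis
      unfolding F_def by (rule measurable_compose_countable[rotated]) measurable
  qed
  have ind_C: "P.indep_vars (\<lambda>_. count_space UNIV) C {..<d}"
    unfolding C_def[abs_def]
    by (rule P.indep_vars_compose2[OF P.indep_vars_restrict[OF ind]])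
      (auto simp: J_def disjoint_family_on_def intro: F_measurable[unfolded J_def])
  have prob_C: "P.prob {g \<in> space P. C i g = b i} = coord_kernel n t (a i) (b i)" if i: "i < d" for i
  proof -
    have "P.indep_vars (\<lambda>_. borel) (\<lambda>(k, c). V ((i, k), c)) UNIV"
      using P.indep_vars_reindex[OF ind, of "\<lambda>(k, c). ((i, k), c)" UNIV] i
      by (auto simp: inj_on_def case_prod_unfold)
    from P.prob_coordinate[OF this _ _ n ab(1)[OF i] ab(2)[OF i] t]
    show ?thesis
      using exp unif i by (simp add: C_eq) (simp add: V_def)
  qed
  have nonempty: "{..<d} \<noteq> {}"
    using d by (auto simp: lessThan_empty_iff)
  have E_eq: "E = (\<Inter>i\<in>{..<d}. C i -` {b i} \<inter> space P)"
    using nonempty by (auto simp: E_def C_eq)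
  have "C i -` {b i} \<inter> space P \<in> sets P" if "i < d" for i
    using ind_C that by (auto simp: P.indep_vars_def intro: measurable_sets)
  then show "E \<in> sets P"
    using nonempty unfolding E_eq by (intro sets.finite_INT) auto
  have "measure P E = (\<Prod>i<d. P.prob (C i -` {b i} \<inter> space P))"
    unfolding E_eq using nonempty by (intro P.indep_varsD_finite[OF ind_C]) auto
  also have "\<dots> = (\<Prod>i<d. coord_kernel n t (a i) (b i))"
    using prob_C by (intro prod.cong refl) (simp add: vimage_def Int_def conj_commute)
  finally show "measure P E = (\<Prod>i<d. coord_kernel n t (a i) (b i))" .
qed

text \<open>Up to a null set, the event is the preimage under \<open>D\<close> of the disjoint boxes
  \<open>{y} \<times> E y\<close>, one for each starting point, and the driving law is a product
  measure.\<close>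

lemma random_walk_law:
  assumes X: "random_walk n d \<mu> M X" and n: "n \<ge> 2" and d: "d \<ge> 1" and t: "t \<ge> 0"
    and x: "x \<in> vertices n d"
  shows "measure M {\<omega> \<in> space M. X t \<omega> = x} =
    (\<Sum>y\<in>vertices n d. pmf \<mu> y * (\<Prod>i<d. coord_kernel n t (y i) (x i)))"
proof -
  define V where "V = vertices n d"
  define P where "P = (\<Pi>\<^sub>M ik\<in>{..<d} \<times> (UNIV :: nat set). jump_law n)"
  have process: "process M V X"
    using X by (simp add: random_walk_def V_def)
  then interpret prob_space M by (simp add: process_def)
  have X_measurable [measurable]: "X s \<in> M \<rightarrow>\<^sub>M count_space V" if "s \<ge> 0" for s
    using process that by (simp add: process_def)
  have X_in: "X s \<omega> \<in> V" if "s \<ge> 0" "\<omega> \<in> space M" for s \<omega>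
    using measurable_space[OF X_measurable] that by simp
  have law: "driving_law n d \<mu> = measure_pmf \<mu> \<Otimes>\<^sub>M P"
    by (simp add: driving_law_def P_def)
  obtain e s where
    "(let D = (\<lambda>\<omega>. (X 0 \<omega>, \<lambda>(i, k)\<in>{..<d} \<times> UNIV. (e i k \<omega>, s i k \<omega>)))
         in D \<in> M \<rightarrow>\<^sub>M driving_law n d \<mu> \<and> distr M (driving_law n d \<mu>) D = driving_law n d \<mu>)"
    and path: "AE \<omega> in M. \<forall>t\<ge>0. \<forall>i<d.
           X t \<omega> i = (X 0 \<omega> i + (\<Sum>k<arrivals (\<lambda>k. e i k \<omega>) t. s i k \<omega>)) mod n"
    using X unfolding random_walk_def by blast
  moreover define D where "D \<omega> = (X 0 \<omega>, \<lambda>(i, k)\<in>{..<d} \<times> UNIV. (e i k \<omega>, s i k \<omega>))" for \<omega>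
  ultimately have D [measurable]: "D \<in> M \<rightarrow>\<^sub>M measure_pmf \<mu> \<Otimes>\<^sub>M P"
    and distr_D: "distr M (measure_pmf \<mu> \<Otimes>\<^sub>M P) D = measure_pmf \<mu> \<Otimes>\<^sub>M P"
    by (auto simp: Let_def law[symmetric] D_def[abs_def])
  define E where "E y = {g \<in> space P. \<forall>i<d. (y i + (\<Sum>k<arrivals (\<lambda>k. fst (g (i, k))) t. snd (g (i, k)))) mod n = x i}" for y
  have E: "E y \<in> sets P" "measure P (E y) = (\<Prod>i<d. coord_kernel n t (y i) (x i))" if "y \<in> V" for y
    using sets_displaced[OF n d t, of y x] measure_displaced[OF n d t, of y x] x that
    by (auto simp: P_def E_def V_def coordinate_in_vertices)
  interpret P: prob_space P
    unfolding P_def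
    by (intro prob_space_PiM prob_space_pair prob_space_exponential_density measure_pmf.prob_space_axioms) simp
  have "prob {\<omega> \<in> space M. X t \<omega> = x} = prob (\<Union>y\<in>V. D -` ({y} \<times> E y) \<inter> space M)"
  proof (rule measure_eq_AE)
    show "AE \<omega> in M. (\<omega> \<in> {\<omega> \<in> space M. X t \<omega> = x}) = (\<omega> \<in> (\<Union>y\<in>V. D -` ({y} \<times> E y) \<inter> space M))"
      using path AE_space
    proof eventually_elim
      case (elim \<omega>)
      have space: "snd (D \<omega>) \<in> space P"
        using measurable_space[OF D elim(2)] by (auto simp: space_pair_measure)
      have jumps: "snd (D \<omega>) (i, k) = (e i k \<omega>, s i k \<omega>)" if "i < d" for i k
        using that by (simp add: D_def)
      have "\<omega> \<in> (\<Union>y\<in>V. D -` ({y} \<times> E y) \<inter> space M) \<longleftrightarrow> snd (D \<omega>) \<in> E (X 0 \<omega>)"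
      proof -
        have "fst (D \<omega>) = X 0 \<omega>" by (simp add: D_def)
        then show ?thesis
          using elim(2) X_in[OF order_refl elim(2)] by (simp add: mem_Times_iff)
      qed
      also have "\<dots> \<longleftrightarrow> (\<forall>i<d. (X 0 \<omega> i + (\<Sum>k<arrivals (\<lambda>k. e i k \<omega>) t. s i k \<omega>)) mod n = x i)"
      proof -
        have "(\<Sum>k<arrivals (\<lambda>k. fst (snd (D \<omega>) (i, k))) t. snd (snd (D \<omega>) (i, k))) =
            (\<Sum>k<arrivals (\<lambda>k. e i k \<omega>) t. s i k \<omega>)" if "i < d" for i
          by (simp add: jumps[OF that])
        then have "(\<forall>i<d. (X 0 \<omega> i + (\<Sum>k<arrivals (\<lambda>k. fst (snd (D \<omega>) (i, k))) t. snd (snd (D \<omega>) (i, k)))) mod n = x i)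
            \<longleftrightarrow> (\<forall>i<d. (X 0 \<omega> i + (\<Sum>k<arrivals (\<lambda>k. e i k \<omega>) t. s i k \<omega>)) mod n = x i)"
          by (intro all_cong1 imp_cong refl) (simp only:)
        with space show ?thesis
          unfolding E_def mem_Collect_eq by blast
      qed
      also have "\<dots> \<longleftrightarrow> (\<forall>i<d. X t \<omega> i = x i)"
        by (intro all_cong1 imp_cong refl) (simp only: elim(1)[rule_format, OF t])
      also have "\<dots> \<longleftrightarrow> X t \<omega> = x"
        using vertices_eqI[of "X t \<omega>" n d x] X_in[OF t elim(2)] x by (auto simp: V_def)
      finally show ?case
        using elim(2) by simp
    qed
    show "{\<omega> \<in> space M. X t \<omega> = x} \<in> events"
      using measurable_sets[OF X_measurable[OF t], of "{x}"] x
      by (simp add: V_def vimage_def Int_def conj_commute)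
    show "(\<Union>y\<in>V. D -` ({y} \<times> E y) \<inter> space M) \<in> events"
      using E by (intro sets.finite_UN measurable_sets[OF D]) (auto simp: V_def)
  qed
  also have "\<dots> = (\<Sum>y\<in>V. prob (D -` ({y} \<times> E y) \<inter> space M))"
    using E by (intro finite_measure_finite_Union)
      (auto simp: V_def disjoint_family_on_def intro!: measurable_sets[OF D])
  also have "\<dots> = (\<Sum>y\<in>V. pmf \<mu> y * (\<Prod>i<d. coord_kernel n t (y i) (x i)))"
  proof (rule sum.cong[OF refl])
    fix y assume y: "y \<in> V"
    have "prob (D -` ({y} \<times> E y) \<inter> space M) = measure (distr M (measure_pmf \<mu> \<Otimes>\<^sub>M P) D) ({y} \<times> E y)"
      using E[OF y] by (subst measure_distr) auto
    also have "\<dots> = measure (measure_pmf \<mu> \<Otimes>\<^sub>M P) ({y} \<times> E y)"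
      by (simp only: distr_D)
    also have "\<dots> = measure (measure_pmf \<mu>) {y} * measure P (E y)"
      using E[OF y] by (simp add: measure_def P.emeasure_pair_measure_Times enn2real_mult)
    finally show "prob (D -` ({y} \<times> E y) \<inter> space M) = pmf \<mu> y * (\<Prod>i<d. coord_kernel n t (y i) (x i))"
      using E[OF y] by (simp add: measure_pmf_single)
  qed
  finally show ?thesis
    by (simp add: V_def)
qed


section \<open>The mean coupling time of a maximal coupling\<close>

definition equilibrium :: "nat \<Rightarrow> nat \<Rightarrow> real" where
  "equilibrium n d = 1 / real n ^ d"

lemma card_vertices: "card (vertices n d) = n ^ d"
  by (simp add: vertices_def card_PiE)

lemma sum_kernel:
  assumes "n \<ge> 2" "a < n"
  shows "(\<Sum>b<n. coord_kernel n t a b) = 1"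
  using assms
  by (simp add: coord_kernel_def sum.distrib sum_distrib_left[symmetric] sum_subtractf of_bool_def sum.delta)

text \<open>After subtracting 1 this is the chi-square distance of one coordinate from uniform: each
  of the \<open>n - 1\<close> nonconstant modes contributes its squared decay factor.\<close>

lemma sum_kernel_squared:
  assumes "n \<ge> 2" "a < n"
  shows "n * (\<Sum>b<n. (coord_kernel n t a b)\<^sup>2) = 1 + (real n - 1) * exp (- (n / (real n - 1)) * t) ^ 2"
proof -
  define e where "e = exp (- (n / (real n - 1)) * t)"
  have kernel: "coord_kernel n t a b = 1 / n + e * (of_bool (a = b) - 1 / n)" for b
    by (simp only: coord_kernel_def e_def)
  have "(coord_kernel n t a b)\<^sup>2 = (1 / n - e / n)\<^sup>2 + of_bool (a = b) * (2 * e * (1 / n - e / n) + e\<^sup>2)" for b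
    unfolding kernel by (simp add: power2_eq_square algebra_simps)
  then have "(\<Sum>b<n. (coord_kernel n t a b)\<^sup>2) = n * (1 / n - e / n)\<^sup>2 + (2 * e * (1 / n - e / n) + e\<^sup>2)"
    using assms by (simp add: sum.distrib sum_distrib_right[symmetric] of_bool_def sum.delta)
  also have "n * \<dots> = 1 + (real n - 1) * e ^ 2"
    using assms by (simp add: power2_eq_square field_simps)
  finally show ?thesis
    by (simp add: e_def)
qed

text \<open>The time at which the squared decay factor \<open>exp (- (n / (n - 1)) * t) ^ 2\<close>
  of a coordinate equals \<open>1 / d\<close>, so that the \<open>d\<close> coordinates together
  contribute an amount of order 1.\<close>

definition mixing_time :: "nat \<Rightarrow> nat \<Rightarrow> real" where
  "mixing_time n d = (real n - 1) / (2 * n) * ln d"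

text \<open>Arises from \<open>exp z - 1 \<le> z * exp z\<close> at
  \<open>z = (n - 1) * exp (- 2 * l * k)\<close>, with \<open>z\<close> replaced by
  \<open>n - 1\<close> in the exponent; the root undoes the square in the Cauchy-Schwarz
  inequality.\<close>

definition tail_const :: "nat \<Rightarrow> real" where
  "tail_const n = sqrt ((real n - 1) * exp (real n - 1))"

lemma exp_minus_one_le: "exp z - 1 \<le> z * exp z" for z :: real
proof -
  have "(1 - z) * exp z \<le> exp (- z) * exp z"
    using exp_ge_add_one_self[of "- z"] by (intro mult_right_mono) auto
  then show ?thesis
    by (simp add: exp_minus algebra_simps)
qed

text \<open>Chi-square distance plus 1 is multiplicative over independent coordinates, and by
  Cauchy-Schwarz the chi-square distance bounds the square of the summed deviations.\<close>

lemma sum_abs_dev_le: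
  assumes n: "n \<ge> 2" and d: "d \<ge> 1"
  defines "w t x \<equiv> \<Prod>i<d. coord_kernel n t 0 (x i)"
  shows "(\<Sum>x\<in>vertices n d. \<bar>w (mixing_time n d + k) x - equilibrium n d\<bar>) \<le> tail_const n * exp (- 1) ^ k"
proof -
  define l where "l = n / (real n - 1)"
  define t where "t = mixing_time n d + k"
  define V where "V = vertices n d"
  define u where "u = equilibrium n d"
  have l: "l \<ge> 1" using n by (simp add: l_def field_simps)
  have V: "finite V" "card V = n ^ d"
    by (auto simp: V_def card_vertices)
  have sum_w: "(\<Sum>x\<in>V. w t x) = 1"
  proof -
    have "(\<Sum>x\<in>V. w t x) = (\<Prod>i<d. \<Sum>b<n. coord_kernel n t 0 b)"
      unfolding V_def w_def vertices_def by (rule prod_sum_PiE[symmetric]) auto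
    then show ?thesis using n by (simp add: sum_kernel)
  qed
  have "n ^ d * (\<Sum>x\<in>V. (w t x)\<^sup>2) = n ^ d * (\<Prod>i<d. \<Sum>b<n. (coord_kernel n t 0 b)\<^sup>2)"
    unfolding V_def w_def vertices_def prod_power_distrib
    by (subst prod_sum_PiE) (auto simp: prod_power_distrib)
  also have "\<dots> = (n * (\<Sum>b<n. (coord_kernel n t 0 b)\<^sup>2)) ^ d"
    by (simp add: power_mult_distrib)
  also have "\<dots> = (1 + (real n - 1) * exp (- l * t) ^ 2) ^ d"
    using n by (subst sum_kernel_squared) (auto simp: l_def)
  also have "exp (- l * t) ^ 2 = exp (- 2 * l * k) / d"
  proof -
    have "2 * (l * mixing_time n d) = ln d"
      using n by (simp add: l_def mixing_time_def field_simps)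
    then have "- 2 * l * t = - 2 * l * k - ln d"
      by (simp add: t_def algebra_simps)
    moreover have "exp (- l * t) ^ 2 = exp (- 2 * l * t)"
      by (simp add: power2_eq_square flip: exp_add)
    ultimately show ?thesis
      using d by (simp add: exp_diff)
  qed
  \<comment> \<open>The factor \<open>1 / d\<close> gained at the mixing time cancels the power
    \<open>d\<close>, by \<open>1 + z \<le> exp z\<close>.\<close>
  also have "(1 + (real n - 1) * (exp (- 2 * l * k) / d)) ^ d \<le> exp ((real n - 1) * exp (- 2 * l * k) / d) ^ d"
    using n by (intro power_mono) (auto intro!: add_nonneg_nonneg exp_ge_add_one_self[THEN order_trans[rotated]])
  also have "\<dots> = exp ((real n - 1) * exp (- 2 * l * k))"
    using d by (simp flip: exp_of_nat_mult)
  finally have sq: "n ^ d * (\<Sum>x\<in>V. (w t x)\<^sup>2) - 1 \<le> exp ((real n - 1) * exp (- 2 * l * k)) - 1"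
    by simp
  also have "\<dots> \<le> (real n - 1) * exp (- 2 * l * k) * exp ((real n - 1) * exp (- 2 * l * k))"
    by (rule exp_minus_one_le)
  also have "\<dots> \<le> (real n - 1) * exp (- 2 * l * k) * exp (real n - 1)"
    using n l by (intro mult_left_mono) (auto simp: mult_le_cancel_left1)
  \<comment> \<open>As \<open>l \<ge> 1\<close>, the decay in \<open>k\<close> is weakened to rate
    1, which keeps \<open>n\<close> out of the geometric ratio.\<close>
  also have "\<dots> \<le> (real n - 1) * (exp (- 1) ^ k)\<^sup>2 * exp (real n - 1)"
  proof -
    have "real k * 1 \<le> real k * l"
      using l by (intro mult_left_mono) auto
    then have "exp (- 2 * l * k) \<le> exp (- 2 * real k)"
      by (simp add: mult_ac)
    also have "\<dots> = (exp (- 1) ^ k)\<^sup>2"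
      by (simp flip: exp_of_nat_mult power_mult add: mult.commute)
    finally show ?thesis
      using n by (intro mult_right_mono mult_left_mono) auto
  qed
  finally have chi: "n ^ d * (\<Sum>x\<in>V. (w t x)\<^sup>2) - 1 \<le> (tail_const n * exp (- 1) ^ k)\<^sup>2"
    using n by (simp add: tail_const_def power_mult_distrib mult_ac)
  have "(\<Sum>x\<in>V. \<bar>w t x - u\<bar>)\<^sup>2 \<le> (\<Sum>x\<in>V. 1\<^sup>2) * (\<Sum>x\<in>V. \<bar>w t x - u\<bar>\<^sup>2)"
    using Cauchy_Schwarz_ineq_sum[of "\<lambda>_. 1" "\<lambda>x. \<bar>w t x - u\<bar>" V] by simp
  also have "\<dots> = n ^ d * (\<Sum>x\<in>V. (w t x)\<^sup>2 - 2 * u * w t x + u\<^sup>2)"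
    by (simp add: V power2_diff mult_ac diff_add_eq)
  also have "\<dots> = n ^ d * ((\<Sum>x\<in>V. (w t x)\<^sup>2) - 2 * u + n ^ d * u\<^sup>2)"
    using V by (simp add: sum.distrib sum_subtractf sum_distrib_left[symmetric] sum_w)
  also have "\<dots> = n ^ d * (\<Sum>x\<in>V. (w t x)\<^sup>2) - 1"
    using n by (simp add: u_def equilibrium_def field_simps power2_eq_square)
  finally have "(\<Sum>x\<in>V. \<bar>w t x - u\<bar>)\<^sup>2 \<le> (tail_const n * exp (- 1) ^ k)\<^sup>2"
    using chi by linarith
  then show ?thesis
    unfolding V_def t_def u_def
    by (rule power2_le_imp_le) (use n in \<open>auto simp: tail_const_def\<close>)
qed

section \<open>Coupling times: measurability, tail sums and the upper bound\<close>

text \<open>Agreement is asked for strictly after \<open>t\<close>, because the infimum may be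
  approached from above; right-continuity carries it from rational times to all later times and to
  \<open>t\<close> itself. Countably many times then suffice for measurability.\<close>

lemma coupling_time_le_iff:
  assumes X: "process M S X" and Y: "process M S Y" and t: "t \<ge> 0" and \<omega>: "\<omega> \<in> space M"
  shows "coupling_time X Y \<omega> \<le> ennreal t \<longleftrightarrow> (\<forall>r\<in>\<rat> \<inter> {t<..}. X r \<omega> = Y r \<omega>)"
proof
  assume le: "coupling_time X Y \<omega> \<le> ennreal t"
  show "\<forall>r\<in>\<rat> \<inter> {t<..}. X r \<omega> = Y r \<omega>"
  proof
    fix r assume "r \<in> \<rat> \<inter> {t<..}"
    then have "coupling_time X Y \<omega> < ennreal r"
      using le t by (auto simp: ennreal_less_iff intro: le_less_trans)
    then obtain u where "0 \<le> u" "\<forall>s\<ge>u. X s \<omega> = Y s \<omega>" "ennreal u < ennreal r"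
      unfolding coupling_time_def by (auto simp: INF_less_iff)
    then show "X r \<omega> = Y r \<omega>"
      by (auto simp: ennreal_less_iff)
  qed
next
  assume eq: "\<forall>r\<in>\<rat> \<inter> {t<..}. X r \<omega> = Y r \<omega>"
  have "X s \<omega> = Y s \<omega>" if "s \<ge> t" for s
  proof -
    have "\<forall>\<^sub>F r in at_right s. X r \<omega> = X s \<omega> \<and> Y r \<omega> = Y s \<omega>"
      using X Y \<omega> t that by (auto simp: process_def intro!: eventually_conj)
    then obtain b where b: "b > s" "\<And>r. s < r \<Longrightarrow> r < b \<Longrightarrow> X r \<omega> = X s \<omega> \<and> Y r \<omega> = Y s \<omega>"
      unfolding eventually_at_right_field by blast
    obtain r where "r \<in> \<rat>" "s < r" "r < b"
      using Rats_dense_in_real[OF b(1)] by blast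
    with b(2)[of r] eq that show ?thesis by auto
  qed
  then show "coupling_time X Y \<omega> \<le> ennreal t"
    unfolding coupling_time_def using t by (intro INF_lower) auto
qed

lemma sets_coupling_time_greater:
  assumes X: "process M S X" and Y: "process M S Y" and S: "countable S" and t: "t \<ge> 0"
  shows "{\<omega> \<in> space M. coupling_time X Y \<omega> > ennreal t} \<in> sets M"
proof -
  have "{\<omega> \<in> space M. X r \<omega> \<noteq> Y r \<omega>} \<in> sets M" if "r \<ge> 0" for r
  proof -
    have "(\<lambda>\<omega>. (X r \<omega>, Y r \<omega>)) \<in> M \<rightarrow>\<^sub>M count_space S \<Otimes>\<^sub>M count_space S"
      using X Y that by (intro measurable_Pair) (auto simp: process_def)
    then have "(\<lambda>\<omega>. (X r \<omega>, Y r \<omega>)) \<in> M \<rightarrow>\<^sub>M count_space (S \<times> S)"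
      using S by (simp add: pair_measure_countable)
    from measurable_sets[OF this, of "{(x, y). x \<in> S \<and> y \<in> S \<and> x \<noteq> y}"]
    have "(\<lambda>\<omega>. (X r \<omega>, Y r \<omega>)) -` {(x, y). x \<in> S \<and> y \<in> S \<and> x \<noteq> y} \<inter> space M \<in> sets M"
      by auto
    also have "(\<lambda>\<omega>. (X r \<omega>, Y r \<omega>)) -` {(x, y). x \<in> S \<and> y \<in> S \<and> x \<noteq> y} \<inter> space M =
        {\<omega> \<in> space M. X r \<omega> \<noteq> Y r \<omega>}"
    proof -
      have "X r \<omega> \<in> S" "Y r \<omega> \<in> S" if "\<omega> \<in> space M" for \<omega>
        using X Y \<open>r \<ge> 0\<close> that measurable_space[of "X r" M "count_space S"]
          measurable_space[of "Y r" M "count_space S"]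
        by (auto simp: process_def)
      then show ?thesis by auto
    qed
    finally show ?thesis .
  qed
  then have "(\<Union>r\<in>\<rat> \<inter> {t<..}. {\<omega> \<in> space M. X r \<omega> \<noteq> Y r \<omega>}) \<in> sets M"
    using t by (intro sets.countable_UN') (auto simp: countable_rat countable_Int1)
  also have "(\<Union>r\<in>\<rat> \<inter> {t<..}. {\<omega> \<in> space M. X r \<omega> \<noteq> Y r \<omega>}) =
      {\<omega> \<in> space M. coupling_time X Y \<omega> > ennreal t}"
    using coupling_time_le_iff[OF X Y t] by (auto simp: not_le[symmetric])
  finally show ?thesis .
qed

text \<open>A discrete layer-cake formula: the sum counts the unit steps by which \<open>x\<close>
  exceeds \<open>T\<close>, and is infinite if \<open>x\<close> is. Integrated, it bounds a mean by
  \<open>T\<close> plus a series of tail probabilities.\<close>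

lemma ennreal_le_sum_indicators:
  fixes x :: ennreal and T :: real
  assumes "T \<ge> 0"
  shows "x \<le> ennreal T + (\<Sum>k. indicator {ennreal (T + real k)<..} x)"
proof (cases "\<exists>m. x \<le> ennreal (T + real m)")
  case True
  define m where "m = (LEAST m. x \<le> ennreal (T + real m))"
  have m: "x \<le> ennreal (T + real m)"
    unfolding m_def using True by (rule LeastI_ex)
  have "x > ennreal (T + real k)" if "k < m" for k
    using not_less_Least[of k "\<lambda>m. x \<le> ennreal (T + real m)"] that by (auto simp: m_def)
  then have "(\<Sum>k<m. indicator {ennreal (T + real k)<..} x) = (of_nat m :: ennreal)"
    by simp
  then have "of_nat m \<le> (\<Sum>k. indicator {ennreal (T + real k)<..} x :: ennreal)"
    using sum_le_suminf[of "\<lambda>k. indicator {ennreal (T + real k)<..} x :: ennreal" "{..<m}"] by simp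
  moreover have "x \<le> ennreal T + of_nat m"
    using m assms by (simp add: ennreal_of_nat_eq_real_of_nat)
  ultimately show ?thesis
    by (meson add_left_mono order_trans)
next
  case False
  then have "(\<Sum>k. indicator {ennreal (T + real k)<..} x) = (\<Sum>k. 1 :: ennreal)"
    by (intro suminf_cong) (auto simp: not_le)
  also have "\<dots> = top"
    by (simp add: suminf_eq_SUP ennreal_SUP_of_nat_eq_top)
  finally show ?thesis by simp
qed

text \<open>Stated through the laws at single times, not through the construction of the walks, so
  that it applies both to maximal couplings of random walks and to the q-hat coupling once that is
  supposed to be maximal.\<close>

lemma maximal_coupling_time_le:
  assumes n: "n \<ge> 2" and d: "d \<ge> 1"
    and X: "process M (vertices n d) X" and Y: "process M (vertices n d) Y"
    and law_X: "\<And>t x. t \<ge> 0 \<Longrightarrow> x \<in> vertices n d \<Longrightarrow>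
      measure M {\<omega> \<in> space M. X t \<omega> = x} = (\<Prod>i<d. coord_kernel n t 0 (x i))"
    and law_Y: "\<And>t x. t \<ge> 0 \<Longrightarrow> x \<in> vertices n d \<Longrightarrow>
      measure M {\<omega> \<in> space M. Y t \<omega> = x} = equilibrium n d"
    and maximal: "is_maximal M (vertices n d) X Y"
  shows "(\<integral>\<^sup>+\<omega>. coupling_time X Y \<omega> \<partial>M) \<le> ennreal (mixing_time n d + 2 * tail_const n)"
proof -
  define V where "V = vertices n d"
  interpret prob_space M using X by (simp add: process_def)
  define T where "T = mixing_time n d"
  have T: "T \<ge> 0"
    using n d by (simp add: T_def mixing_time_def)
  define G where "G k = {\<omega> \<in> space M. coupling_time X Y \<omega> > ennreal (T + real k)}" for k :: nat
  have G: "G k \<in> events" for k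
    unfolding G_def using T by (intro sets_coupling_time_greater[OF X Y]) (auto intro: countable_finite)
  have tail: "prob (G k) \<le> tail_const n * exp (- 1) ^ k" for k
  proof -
    let ?P = "distr M (count_space V) (X (T + k))" and ?Q = "distr M (count_space V) (Y (T + k))"
    have X_measurable [measurable]: "X (T + k) \<in> M \<rightarrow>\<^sub>M count_space V"
      and Y_measurable [measurable]: "Y (T + k) \<in> M \<rightarrow>\<^sub>M count_space V"
      using X Y T by (auto simp: process_def V_def)
    interpret P: prob_space ?P by (rule prob_space_distr) measurable
    interpret Q: prob_space ?Q by (rule prob_space_distr) measurable
    have V: "finite V" by (simp add: V_def)
    have P: "measure ?P {x} = (\<Prod>i<d. coord_kernel n (T + k) 0 (x i))" if "x \<in> V" for x
      using law_X[of "T + k" x] that T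
      by (subst measure_distr[OF X_measurable]) (auto simp: V_def vimage_def Int_def conj_commute)
    have Q: "measure ?Q {x} = equilibrium n d" if "x \<in> V" for x
      using law_Y[of "T + k" x] that T
      by (subst measure_distr[OF Y_measurable]) (auto simp: V_def vimage_def Int_def conj_commute)
    \<comment> \<open>The full sum of absolute deviations is twice the total variation distance; the
      lost factor affects only the additive constant of the final bound.\<close>
    have "tv_dist ?P ?Q \<le> (\<Sum>x\<in>V. \<bar>(\<Prod>i<d. coord_kernel n (T + k) 0 (x i)) - equilibrium n d\<bar>)"
      unfolding tv_dist_def
    proof (rule cSUP_least)
      fix A assume "A \<in> sets ?P"
      then have A: "A \<subseteq> V" "finite A"
        using V finite_subset by auto
      have "measure ?P A = (\<Sum>x\<in>A. measure ?P {x})" "measure ?Q A = (\<Sum>x\<in>A. measure ?Q {x})"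
        using A by (auto intro!: P.finite_measure_eq_sum_singleton Q.finite_measure_eq_sum_singleton)
      then have "measure ?P A - measure ?Q A = (\<Sum>x\<in>A. (\<Prod>i<d. coord_kernel n (T + k) 0 (x i)) - equilibrium n d)"
        using A P Q by (simp add: sum_subtractf subset_iff)
      also have "\<bar>\<dots>\<bar> \<le> (\<Sum>x\<in>A. \<bar>(\<Prod>i<d. coord_kernel n (T + k) 0 (x i)) - equilibrium n d\<bar>)"
        by (rule sum_abs)
      also have "\<dots> \<le> (\<Sum>x\<in>V. \<bar>(\<Prod>i<d. coord_kernel n (T + k) 0 (x i)) - equilibrium n d\<bar>)"
        using A V by (intro sum_mono2) auto
      finally show "\<bar>measure ?P A - measure ?Q A\<bar> \<le> (\<Sum>x\<in>V. \<bar>(\<Prod>i<d. coord_kernel n (T + k) 0 (x i)) - equilibrium n d\<bar>)" .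
    qed (auto intro: exI[of _ "{}"])
    also have "\<dots> \<le> tail_const n * exp (- 1) ^ k"
      unfolding V_def T_def by (rule sum_abs_dev_le[OF n d])
    also have "tv_dist ?P ?Q = prob (G k)"
      using maximal T by (simp add: is_maximal_def G_def V_def del: ennreal_plus)
    finally show ?thesis .
  qed
  have "(\<integral>\<^sup>+\<omega>. coupling_time X Y \<omega> \<partial>M) \<le> (\<integral>\<^sup>+\<omega>. ennreal T + (\<Sum>k. indicator (G k) \<omega>) \<partial>M)"
  proof (rule nn_integral_mono)
    fix \<omega> assume "\<omega> \<in> space M"
    then have "indicator (G k) \<omega> = (indicator {ennreal (T + real k)<..} (coupling_time X Y \<omega>) :: ennreal)" for k
      by (simp add: G_def indicator_def)
    then show "coupling_time X Y \<omega> \<le> ennreal T + (\<Sum>k. indicator (G k) \<omega>)"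
      using ennreal_le_sum_indicators[OF T, of "coupling_time X Y \<omega>"] by simp
  qed
  also have "\<dots> = ennreal T + (\<Sum>k. emeasure M (G k))"
    using G by (subst nn_integral_add) (auto simp: nn_integral_suminf emeasure_space_1)
  also have "(\<Sum>k. emeasure M (G k)) \<le> (\<Sum>k. ennreal (tail_const n * exp (- 1) ^ k))"
    using tail by (intro suminf_le) (auto simp: emeasure_eq_measure intro!: ennreal_leI)
  also have "(\<Sum>k. ennreal (tail_const n * exp (- 1) ^ k)) = ennreal (tail_const n * (1 / (1 - exp (- 1))))"
    using n by (intro suminf_ennreal_eq sums_mult geometric_sums) (auto simp: tail_const_def)
  \<comment> \<open>The sum of the geometric series is below 2 because \<open>exp 1 \<ge> 2\<close>;
    this is the 2 in front of \<open>tail_const n\<close>.\<close>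
  also have "ennreal (tail_const n * (1 / (1 - exp (- 1)))) \<le> ennreal (tail_const n * 2)"
  proof (intro ennreal_leI mult_left_mono)
    have "exp (- 1 :: real) \<le> 1 / 2"
      using exp_ge_add_one_self[of "1 :: real"] by (simp add: exp_minus field_simps)
    then show "1 / (1 - exp (- 1 :: real)) \<le> 2"
      by (simp add: field_simps)
  qed (use n in \<open>simp add: tail_const_def\<close>)
  finally show ?thesis
    using T n by (simp add: T_def tail_const_def ennreal_plus[symmetric] mult.commute add_left_mono del: ennreal_plus)
qed


section \<open>Markov jump processes\<close>

text \<open>The semigroup, existentially quantified in \<open>markov_jump_process\<close>, becomes a
  parameter, so that it can act on functions of the state.\<close>

locale markov_jump = prob_space M for M :: "'w measure" +
  fixes S :: "'s set" and r :: "'s \<Rightarrow> 's \<Rightarrow> real" and \<mu> :: "'s pmf" and Z :: "real \<Rightarrow> 'w \<Rightarrow> 's"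
    and p :: "real \<Rightarrow> 's \<Rightarrow> 's pmf"
  assumes finite_S: "finite S" and process_Z: "process M S Z"
    and initial: "\<And>z. z \<in> S \<Longrightarrow> prob {\<omega> \<in> space M. Z 0 \<omega> = z} = pmf \<mu> z"
    and semigroup: "transition_semigroup S r p"
    and markov: "\<And>(m :: nat) u z. 0 \<le> u 0 \<Longrightarrow> (\<And>i. i \<le> m \<Longrightarrow> u i \<le> u (Suc i)) \<Longrightarrow>
      (\<And>i. i \<le> Suc m \<Longrightarrow> z i \<in> S) \<Longrightarrow>
      prob {\<omega> \<in> space M. \<forall>i\<le>Suc m. Z (u i) \<omega> = z i} =
      prob {\<omega> \<in> space M. \<forall>i\<le>m. Z (u i) \<omega> = z i} * pmf (p (u (Suc m) - u m) (z m)) (z (Suc m))"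
begin

lemma Z_measurable: "t \<ge> 0 \<Longrightarrow> Z t \<in> M \<rightarrow>\<^sub>M count_space S"
  using process_Z by (simp add: process_def)

lemma Z_in: "t \<ge> 0 \<Longrightarrow> \<omega> \<in> space M \<Longrightarrow> Z t \<omega> \<in> S"
  using measurable_space[OF Z_measurable] by simp

lemma sets_Z: "t \<ge> 0 \<Longrightarrow> {\<omega> \<in> space M. Q (Z t \<omega>)} \<in> events"
proof -
  assume t: "t \<ge> 0"
  have "Z t -` {z \<in> S. Q z} \<inter> space M \<in> events"
    by (rule measurable_sets[OF Z_measurable[OF t]]) auto
  also have "Z t -` {z \<in> S. Q z} \<inter> space M = {\<omega> \<in> space M. Q (Z t \<omega>)}"
    using Z_in[OF t] by auto
  finally show ?thesis .
qed

lemma prob_eq_sum: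
  assumes "t \<ge> 0"
  shows "prob {\<omega> \<in> space M. Q (Z t \<omega>)} = (\<Sum>z\<in>{z \<in> S. Q z}. prob {\<omega> \<in> space M. Z t \<omega> = z})"
proof -
  have "{\<omega> \<in> space M. Q (Z t \<omega>)} = (\<Union>z\<in>{z \<in> S. Q z}. {\<omega> \<in> space M. Z t \<omega> = z})"
    using Z_in[OF assms] by auto
  then show ?thesis
    using finite_S sets_Z[OF assms]
    by (simp add: disjoint_family_on_def, subst finite_measure_finite_Union)
      (auto simp: disjoint_family_on_def)
qed

lemma two_point:
  assumes "s \<ge> 0" "t \<ge> 0" "x \<in> S" "y \<in> S"
  shows "prob {\<omega> \<in> space M. Z s \<omega> = x \<and> Z (s + t) \<omega> = y} =
    prob {\<omega> \<in> space M. Z s \<omega> = x} * pmf (p t x) y"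
  using markov[of "\<lambda>i. if i = 0 then s else s + t" 0 "\<lambda>i. if i = 0 then x else y"] assms
  by (simp add: le_Suc_eq conj_commute all_conj_distrib cong: conj_cong)

lemma law_add:
  assumes "s \<ge> 0" "t \<ge> 0" "y \<in> S"
  shows "prob {\<omega> \<in> space M. Z (s + t) \<omega> = y} =
    (\<Sum>x\<in>S. prob {\<omega> \<in> space M. Z s \<omega> = x} * pmf (p t x) y)"
proof -
  have "{\<omega> \<in> space M. Z (s + t) \<omega> = y} = (\<Union>x\<in>S. {\<omega> \<in> space M. Z s \<omega> = x \<and> Z (s + t) \<omega> = y})"
    using Z_in[OF assms(1)] by auto
  moreover have "{\<omega> \<in> space M. Z s \<omega> = x \<and> Z (s + t) \<omega> = y} \<in> events" for x
    using sets_Z[of s "\<lambda>z. z = x"] sets_Z[of "s + t" "\<lambda>z. z = y"] assms by auto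
  ultimately have "prob {\<omega> \<in> space M. Z (s + t) \<omega> = y} =
      (\<Sum>x\<in>S. prob {\<omega> \<in> space M. Z s \<omega> = x \<and> Z (s + t) \<omega> = y})"
    using finite_S
    by (simp only:, subst finite_measure_finite_Union) (auto simp: disjoint_family_on_def)
  then show ?thesis
    using assms by (simp add: two_point)
qed

section \<open>Semigroup, generator and means of functions of the state\<close>

definition transit :: "real \<Rightarrow> ('s \<Rightarrow> real) \<Rightarrow> 's \<Rightarrow> real" where
  "transit t F x = (\<Sum>y\<in>S. pmf (p t x) y * F y)"

text \<open>The difference \<open>F y - F x\<close> suppresses the diagonal of \<open>r\<close>,
  whose values are arbitrary; for \<open>hat_rate\<close> they collect the moves that change
  nothing.\<close>

definition gen :: "('s \<Rightarrow> real) \<Rightarrow> 's \<Rightarrow> real" where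
  "gen F x = (\<Sum>y\<in>S. r x y * (F y - F x))"

definition expect :: "real \<Rightarrow> ('s \<Rightarrow> real) \<Rightarrow> real" where
  "expect t F = (\<Sum>z\<in>S. prob {\<omega> \<in> space M. Z t \<omega> = z} * F z)"

lemma expect_add:
  assumes "s \<ge> 0" "t \<ge> 0"
  shows "expect (s + t) F = expect s (transit t F)"
proof -
  have "expect (s + t) F =
      (\<Sum>y\<in>S. \<Sum>x\<in>S. prob {\<omega> \<in> space M. Z s \<omega> = x} * pmf (p t x) y * F y)"
    using assms by (simp add: expect_def law_add sum_distrib_right)
  also have "\<dots> = (\<Sum>x\<in>S. \<Sum>y\<in>S. prob {\<omega> \<in> space M. Z s \<omega> = x} * pmf (p t x) y * F y)"
    by (rule sum.swap)
  finally show ?thesis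
    by (simp add: expect_def transit_def sum_distrib_left mult.assoc)
qed

lemma expect_mono: "(\<And>z. z \<in> S \<Longrightarrow> F z \<le> G z) \<Longrightarrow> expect t F \<le> expect t G"
  unfolding expect_def by (intro sum_mono mult_left_mono) auto

lemma sum_transit:
  assumes "t \<ge> 0" "x \<in> S"
  shows "(\<Sum>y\<in>S. pmf (p t x) y) = 1"
  using semigroup assms finite_S
  by (intro sum_pmf_eq_1) (auto simp: transition_semigroup_def)

text \<open>Averaging does not increase the supremum norm; this stops errors from growing when steps
  are iterated.\<close>

lemma transit_bound:
  assumes "t \<ge> 0" "x \<in> S" "\<And>z. z \<in> S \<Longrightarrow> \<bar>F z\<bar> \<le> C"
  shows "\<bar>transit t F x\<bar> \<le> C"
proof -
  have "\<bar>transit t F x\<bar> \<le> (\<Sum>y\<in>S. \<bar>pmf (p t x) y * F y\<bar>)"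
    unfolding transit_def by (rule sum_abs)
  also have "\<dots> \<le> (\<Sum>y\<in>S. pmf (p t x) y * C)"
    using assms(3) by (intro sum_mono) (auto simp: abs_mult intro!: mult_left_mono)
  also have "\<dots> = C"
    using sum_transit[OF assms(1,2)] by (simp flip: sum_distrib_right)
  finally show ?thesis .
qed

lemma transit_add:
  assumes "s \<ge> 0" "t \<ge> 0" "x \<in> S"
  shows "transit (s + t) F x = transit s (transit t F) x"
proof -
  have "pmf (p (s + t) x) z = (\<Sum>y\<in>S. pmf (p s x) y * pmf (p t y) z)" for z
  proof -
    have "p (s + t) x = bind_pmf (p s x) (p t)" "set_pmf (p s x) \<subseteq> S"
      using semigroup assms by (auto simp: transition_semigroup_def)
    then show ?thesis
      using finite_S by (simp add: pmf_bind) (subst integral_measure_pmf[of S], auto)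
  qed
  then have "transit (s + t) F x = (\<Sum>z\<in>S. \<Sum>y\<in>S. pmf (p s x) y * pmf (p t y) z * F z)"
    by (simp add: transit_def sum_distrib_right)
  also have "\<dots> = (\<Sum>y\<in>S. \<Sum>z\<in>S. pmf (p s x) y * pmf (p t y) z * F z)"
    by (rule sum.swap)
  finally show ?thesis
    by (simp add: transit_def sum_distrib_left mult.assoc)
qed

lemma transit_0: "x \<in> S \<Longrightarrow> transit 0 F x = F x"
  using semigroup finite_S
  by (simp add: transition_semigroup_def transit_def pmf_return indicator_def if_distrib[of "\<lambda>a. a * _"] sum.delta cong: if_cong)

lemma transit_diff: "transit t (\<lambda>z. F z - a * G z) x = transit t F x - a * transit t G x"
  by (simp add: transit_def algebra_simps sum_subtractf sum_distrib_left)

text \<open>Total mass 1 lets \<open>F x\<close> be subtracted inside the sum. This removes the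
  diagonal transition probability, the one whose derivative is not prescribed.\<close>

lemma transit_derivative:
  assumes x: "x \<in> S"
  shows "((\<lambda>h. (transit h F x - F x) / h) \<longlongrightarrow> gen F x) (at_right 0)"
proof -
  have "((\<lambda>h. \<Sum>y\<in>S. pmf (p h x) y / h * (F y - F x)) \<longlongrightarrow> gen F x) (at_right 0)"
    unfolding gen_def
  proof (rule tendsto_sum)
    fix y assume y: "y \<in> S"
    show "((\<lambda>h. pmf (p h x) y / h * (F y - F x)) \<longlongrightarrow> r x y * (F y - F x)) (at_right 0)"
    proof (cases "x = y")
      case False
      then have "((\<lambda>h. pmf (p h x) y / h) \<longlongrightarrow> r x y) (at_right 0)"
        using semigroup x y by (auto simp: transition_semigroup_def)
      then show ?thesis by (intro tendsto_intros)
    qed simp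
  qed
  moreover have "\<forall>\<^sub>F h in at_right 0. (\<Sum>y\<in>S. pmf (p h x) y / h * (F y - F x)) = (transit h F x - F x) / h"
    using eventually_at_right_less[of 0]
  proof eventually_elim
    case (elim h)
    then have "(\<Sum>y\<in>S. pmf (p h x) y) = 1"
      using sum_transit x by simp
    then have "transit h F x - F x = (\<Sum>y\<in>S. pmf (p h x) y * (F y - F x))"
      by (simp add: transit_def right_diff_distrib sum_subtractf flip: sum_distrib_right)
    then show ?case
      by (simp add: sum_divide_distrib)
  qed
  ultimately show ?thesis
    by (rule Lim_transform_eventually)
qed

text \<open>Finiteness of \<open>S\<close> gives one step size for all states, as the grid arguments
  require.\<close>

lemma transit_first_order:
  assumes "\<epsilon> > 0"
  shows "\<forall>\<^sub>F h in at_right 0. \<forall>x\<in>S. \<bar>transit h F x - F x - h * gen F x\<bar> \<le> \<epsilon> * h"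
proof (subst eventually_ball_finite_distrib[OF finite_S], intro ballI)
  fix x assume "x \<in> S"
  from tendstoD[OF transit_derivative[OF this, of F] assms] eventually_at_right_less[of 0]
  show "\<forall>\<^sub>F h in at_right 0. \<bar>transit h F x - F x - h * gen F x\<bar> \<le> \<epsilon> * h"
  proof eventually_elim
    case (elim h)
    have "transit h F x - F x - h * gen F x = ((transit h F x - F x) / h - gen F x) * h"
      using elim by (simp add: field_simps)
    also have "\<bar>\<dots>\<bar> \<le> \<epsilon> * h"
      using elim by (simp add: abs_mult dist_real_def mult_right_mono)
    finally show ?case .
  qed
qed

text \<open>Only derivatives at time 0 are known, so \<open>[0, t]\<close> is cut into
  \<open>k\<close> steps of length \<open>h\<close>. In each of them \<open>transit h F\<close> is
  \<open>exp (- c * h) * F\<close> up to an error of order \<open>\<epsilon> * h\<close>; the errors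
  add up to order \<open>\<epsilon> * t\<close>, and \<open>\<epsilon>\<close> is arbitrary.\<close>

lemma transit_eigenfunction:
  assumes eigen: "\<And>x. x \<in> S \<Longrightarrow> gen F x = - c * F x" and c: "c \<ge> 0" and t: "t \<ge> 0" and x: "x \<in> S"
  shows "transit t F x = exp (- c * t) * F x"
proof -
  define C where "C = (\<Sum>z\<in>S. \<bar>F z\<bar>) + 1"
  have C: "\<bar>F z\<bar> \<le> C" if "z \<in> S" for z
    using member_le_sum[of z S "\<lambda>z. \<bar>F z\<bar>"] finite_S that by (simp add: C_def)
  have C_pos: "C > 0"
    by (auto simp: C_def intro!: add_nonneg_pos sum_nonneg)
  have bound: "\<bar>transit t F x - exp (- c * t) * F x\<bar> \<le> t * (\<epsilon> + C * \<epsilon>)" if \<epsilon>: "\<epsilon> > 0" for \<epsilon>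
  proof -
    have "((\<lambda>h. (exp (- c * h) - exp (- c * 0)) / (h - 0)) \<longlongrightarrow> - c) (at_right 0)"
    proof -
      have "((\<lambda>h. exp (- c * h)) has_field_derivative - c * exp (- c * 0)) (at 0)"
        by (auto intro!: derivative_eq_intros)
      then have "((\<lambda>h. (exp (- c * h) - exp (- c * 0)) / (h - 0)) \<longlongrightarrow> - c) (at 0)"
        by (simp add: has_field_derivative_iff)
      then show ?thesis
        by (rule filterlim_mono) (auto simp: at_within_le_at)
    qed
    from tendstoD[OF this \<epsilon>]
    have "\<forall>\<^sub>F h in at_right 0. \<bar>exp (- c * h) - 1 + c * h\<bar> \<le> \<epsilon> * h"
      using eventually_at_right_less[of 0]
    proof eventually_elim
      case (elim h)
      have "exp (- c * h) - 1 + c * h = ((exp (- c * h) - 1) / h + c) * h"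
        using elim by (simp add: field_simps)
      also have "\<bar>\<dots>\<bar> \<le> \<epsilon> * h"
        using elim by (simp add: abs_mult dist_real_def mult_right_mono)
      finally show ?case .
    qed
    then have "\<forall>\<^sub>F h in at_right 0. \<forall>z\<in>S. \<bar>transit h F z - exp (- c * h) * F z\<bar> \<le> h * (\<epsilon> + C * \<epsilon>)"
      using transit_first_order[OF \<epsilon>, of F] eventually_at_right_less[of 0]
    proof eventually_elim
      case (elim h)
      show ?case
      proof
        fix z assume z: "z \<in> S"
        have "transit h F z - exp (- c * h) * F z =
            (transit h F z - F z - h * gen F z) - (exp (- c * h) - 1 + c * h) * F z"
          using eigen[OF z] by (simp add: algebra_simps)
        also have "\<bar>\<dots>\<bar> \<le> \<bar>transit h F z - F z - h * gen F z\<bar> + \<bar>exp (- c * h) - 1 + c * h\<bar> * \<bar>F z\<bar>"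
          by (simp only: abs_mult[symmetric] abs_triangle_ineq4)
        also have "\<dots> \<le> \<epsilon> * h + \<epsilon> * h * C"
          using elim z C[OF z] \<epsilon> by (intro add_mono mult_mono) auto
        finally show "\<bar>transit h F z - exp (- c * h) * F z\<bar> \<le> h * (\<epsilon> + C * \<epsilon>)"
          by (simp add: algebra_simps)
      qed
    qed
    then obtain b where b: "b > 0"
      "\<And>h z. 0 < h \<Longrightarrow> h < b \<Longrightarrow> z \<in> S \<Longrightarrow> \<bar>transit h F z - exp (- c * h) * F z\<bar> \<le> h * (\<epsilon> + C * \<epsilon>)"
      unfolding eventually_at_right_field by blast
    obtain k :: nat where k: "k > 0" "t / b < real k"
      using reals_Archimedean2[of "t / b"] t b(1)
      by (metis bot_nat_0.not_eq_extremum divide_nonneg_pos not_le of_nat_0)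
    define h where "h = t / k"
    show ?thesis
    proof (cases "t = 0")
      case True
      then show ?thesis using x by (simp add: transit_0)
    next
      case False
      then have h: "0 < h" "h < b"
        using t k b(1) by (auto simp: h_def field_simps)
      have "\<bar>transit (real j * h) F z - exp (- c * (real j * h)) * F z\<bar> \<le> real j * h * (\<epsilon> + C * \<epsilon>)"
        if "z \<in> S" for j z
        using that
      proof (induction j arbitrary: z)
        case 0
        then show ?case by (simp add: transit_0)
      next
        case (Suc j)
        let ?e = "exp (- c * (real j * h))"
        have semigroup_step: "transit (real (Suc j) * h) F z = transit h (transit (real j * h) F) z"
          using transit_add[of h "real j * h" z F] h Suc.prems by (simp add: algebra_simps)
        have exp_step: "exp (- c * (real (Suc j) * h)) = exp (- c * h) * ?e"
          by (simp add: algebra_simps flip: exp_add)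
        \<comment> \<open>The accumulated error is averaged by the new step and the new error is
          multiplied by \<open>?e\<close>, which is at most 1; neither is amplified.\<close>
        have "transit (real (Suc j) * h) F z - exp (- c * (real (Suc j) * h)) * F z =
            transit h (\<lambda>z. transit (real j * h) F z - ?e * F z) z + ?e * (transit h F z - exp (- c * h) * F z)"
          unfolding semigroup_step exp_step transit_diff by (simp add: algebra_simps)
        then have "\<bar>transit (real (Suc j) * h) F z - exp (- c * (real (Suc j) * h)) * F z\<bar> \<le>
            \<bar>transit h (\<lambda>z. transit (real j * h) F z - ?e * F z) z\<bar> + ?e * \<bar>transit h F z - exp (- c * h) * F z\<bar>"
          by (simp only:) (rule order_trans[OF abs_triangle_ineq], simp add: abs_mult)
        also have "\<dots> \<le> real j * h * (\<epsilon> + C * \<epsilon>) + 1 * (h * (\<epsilon> + C * \<epsilon>))"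
          using h c by (intro add_mono mult_mono transit_bound Suc b(2)) (auto simp: mult_nonneg_nonneg)
        finally show ?case
          by (simp add: algebra_simps)
      qed
      from this[OF x, of k] show ?thesis
        using k by (simp add: h_def)
    qed
  qed
  have "((\<lambda>\<epsilon>. t * (\<epsilon> + C * \<epsilon>)) \<longlongrightarrow> t * (0 + C * 0)) (at_right 0)"
    by (intro tendsto_intros)
  moreover have "\<forall>\<^sub>F \<epsilon> in at_right 0. \<bar>transit t F x - exp (- c * t) * F x\<bar> \<le> t * (\<epsilon> + C * \<epsilon>)"
    using eventually_at_right_less[of 0] by eventually_elim (rule bound)
  ultimately have "\<bar>transit t F x - exp (- c * t) * F x\<bar> \<le> t * (0 + C * 0)"
    by (intro tendsto_lowerbound) auto
  then show ?thesis by simp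
qed

lemma expect_eigenfunction:
  assumes "\<And>x. x \<in> S \<Longrightarrow> gen F x = - c * F x" "c \<ge> 0" "t \<ge> 0"
  shows "expect t F = exp (- c * t) * expect 0 F"
proof -
  have "expect t F = expect 0 (transit t F)"
    using expect_add[of 0 t F] assms(3) by simp
  also have "\<dots> = (\<Sum>z\<in>S. prob {\<omega> \<in> space M. Z 0 \<omega> = z} * (exp (- c * t) * F z))"
    unfolding expect_def by (intro sum.cong refl) (simp only: transit_eigenfunction[OF assms])
  finally show ?thesis
    by (simp add: expect_def sum_distrib_left mult_ac)
qed

lemma expect_sum: "expect t (\<lambda>z. \<Sum>a\<in>A. w a * F a z) = (\<Sum>a\<in>A. w a * expect t (F a))"
  unfolding expect_def sum_distrib_left by (subst sum.swap) (simp add: mult_ac)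

lemma expect_indicator:
  assumes "t \<ge> 0"
  shows "expect t (\<lambda>z. of_bool (Q z)) = prob {\<omega> \<in> space M. Q (Z t \<omega>)}"
  using finite_S by (subst prob_eq_sum[OF assms]) (simp add: expect_def of_bool_def if_distrib[of "\<lambda>a. _ * a"] sum.inter_filter cong: if_cong)

end

section \<open>From a drift bound to a lower bound for the mean coupling time\<close>

text \<open>Grid times at which the walks differ lie before any \<open>u\<close> from which on they
  agree, so at most \<open>u / h\<close> indices count. Starting at \<open>k = 1\<close> is
  essential: index 0 would count a full mesh even if the walks merge sooner.\<close>

lemma time_apart_le_coupling_time:
  assumes h: "h > 0"
  shows "(\<Sum>k=1..K. ennreal h * of_bool (X (real k * h) \<omega> \<noteq> Y (real k * h) \<omega>)) \<le> coupling_time X Y \<omega>"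
  unfolding coupling_time_def
proof (rule INF_greatest)
  fix u assume "u \<in> {t. 0 \<le> t \<and> (\<forall>s\<ge>t. X s \<omega> = Y s \<omega>)}"
  then have u: "u \<ge> 0" "\<And>s. s \<ge> u \<Longrightarrow> X s \<omega> = Y s \<omega>" by auto
  define B where "B = {k \<in> {1..K}. X (real k * h) \<omega> \<noteq> Y (real k * h) \<omega>}"
  have "real (card B) * h \<le> u"
  proof (cases "B = {}")
    case False
    have B: "finite B" by (simp add: B_def)
    have "B \<subseteq> {1..Max B}"
      using B by (auto simp: B_def)
    then have "card B \<le> Max B"
      using card_mono[of "{1..Max B}" B] by simp
    then have "real (card B) * h \<le> real (Max B) * h"
      using h by (intro mult_right_mono) auto
    also have "\<dots> < u"
      using Max_in[OF B False] u(2)[of "real (Max B) * h"] by (force simp: B_def)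
    finally show ?thesis by simp
  qed (use u in auto)
  moreover have "(\<Sum>k=1..K. ennreal h * of_bool (X (real k * h) \<omega> \<noteq> Y (real k * h) \<omega>)) = of_nat (card B) * ennreal h"
    by (simp add: B_def of_bool_def if_distrib[of "\<lambda>a. _ * a"] sum.inter_filter[symmetric] cong: if_cong)
  moreover have "of_nat (card B) * ennreal h = ennreal (real (card B) * h)"
    using h by (simp add: ennreal_mult ennreal_of_nat_eq_real_of_nat)
  ultimately show "(\<Sum>k=1..K. ennreal h * of_bool (X (real k * h) \<omega> \<noteq> Y (real k * h) \<omega>)) \<le> ennreal u"
    by (simp add: ennreal_leI)
qed

context markov_jump
begin

text \<open>A discrete Dynkin inequality. Where \<open>Q\<close> fails, \<open>F\<close> is 0 and,
  being nonnegative, cannot fall further, which is why the loss is charged to \<open>Q\<close>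
  alone. The step size works for all times \<open>s\<close> at once.\<close>

lemma expect_step_ge:
  assumes nonneg: "\<And>z. z \<in> S \<Longrightarrow> F z \<ge> 0"
    and zero: "\<And>z. z \<in> S \<Longrightarrow> \<not> Q z \<Longrightarrow> F z = 0"
    and gen: "\<And>z. z \<in> S \<Longrightarrow> Q z \<Longrightarrow> gen F z \<ge> - 1"
    and "\<epsilon> > 0"
  shows "\<forall>\<^sub>F h in at_right 0. \<forall>s\<ge>0.
    expect s F - h * (1 + \<epsilon>) * prob {\<omega> \<in> space M. Q (Z s \<omega>)} \<le> expect (s + h) F"
  using transit_first_order[OF \<open>\<epsilon> > 0\<close>, of F] eventually_at_right_less[of 0]
proof eventually_elim
  case (elim h)
  have "F z - h * (1 + \<epsilon>) * of_bool (Q z) \<le> transit h F z" if z: "z \<in> S" for z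
  proof (cases "Q z")
    case True
    have "h * gen F z \<ge> h * - 1"
      using elim gen[OF z True] by (intro mult_left_mono) auto
    moreover have "\<bar>transit h F z - F z - h * gen F z\<bar> \<le> \<epsilon> * h"
      using elim z by blast
    ultimately show ?thesis
      using True by (simp add: algebra_simps abs_le_iff)
  next
    case False
    then show ?thesis
      using zero[OF z] nonneg by (simp add: transit_def sum_nonneg)
  qed
  then have "expect s (\<lambda>z. F z - h * (1 + \<epsilon>) * of_bool (Q z)) \<le> expect s (transit h F)" for s
    by (rule expect_mono)
  moreover have "expect s (\<lambda>z. F z - h * (1 + \<epsilon>) * of_bool (Q z)) =
      expect s F - h * (1 + \<epsilon>) * expect s (\<lambda>z. of_bool (Q z))" for s
    by (simp add: expect_def right_diff_distrib sum_subtractf sum_distrib_left mult.left_commute)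
  ultimately show ?case
    using elim by (simp add: expect_indicator[symmetric] expect_add)
qed

end

text \<open>Summing the one-step estimates bounds the initial mean of \<open>F\<close> by its mean
  at a late grid time plus, nearly, the mean time spent apart, which is at most the mean coupling
  time. If the latter is finite, the probability of being apart is summable along the grid; since
  \<open>F\<close> is bounded and vanishes on the diagonal, the late term tends to 0.\<close>

lemma coupling_time_ge:
  assumes "markov_jump M S r \<mu> (\<lambda>t \<omega>. (X t \<omega>, Y t \<omega>)) p"
    and nonneg: "\<And>z. z \<in> S \<Longrightarrow> F z \<ge> 0"
    and zero: "\<And>x. (x, x) \<in> S \<Longrightarrow> F (x, x) = 0"
    and gen: "\<And>x y. (x, y) \<in> S \<Longrightarrow> x \<noteq> y \<Longrightarrow> markov_jump.gen S r F (x, y) \<ge> - 1"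
  shows "ennreal (\<Sum>z\<in>S. pmf \<mu> z * F z) \<le> (\<integral>\<^sup>+\<omega>. coupling_time X Y \<omega> \<partial>M)"
proof (cases "(\<integral>\<^sup>+\<omega>. coupling_time X Y \<omega> \<partial>M)")
  case (real T)
  interpret markov_jump M S r \<mu> "\<lambda>t \<omega>. (X t \<omega>, Y t \<omega>)" p by fact
  define P where "P t = prob {\<omega> \<in> space M. X t \<omega> \<noteq> Y t \<omega>}" for t
  define C where "C = (\<Sum>z\<in>S. F z)"
  have F_le: "F z \<le> C * of_bool (fst z \<noteq> snd z)" if "z \<in> S" for z
  proof (cases "fst z = snd z")
    case True
    then show ?thesis
      using zero[of "fst z"] that by (cases z) simp
  next
    case False
    then show ?thesis
      using member_le_sum[OF that, of F] nonneg finite_S by (simp add: C_def)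
  qed
  have expect_le: "expect t F \<le> C * P t" if "t \<ge> 0" for t
  proof -
    have "expect t F \<le> expect t (\<lambda>z. C * of_bool (fst z \<noteq> snd z))"
      by (rule expect_mono) (rule F_le)
    also have "\<dots> = C * expect t (\<lambda>z. of_bool (fst z \<noteq> snd z))"
      by (simp add: expect_def sum_distrib_left mult.left_commute)
    also have "\<dots> = C * P t"
      by (subst expect_indicator[OF that]) (simp add: P_def)
    finally show ?thesis .
  qed
  have sum_le: "h * (\<Sum>k=1..K. P (real k * h)) \<le> T" if h: "h > 0" for h K
  proof -
    have "ennreal (h * (\<Sum>k=1..K. P (real k * h))) = (\<Sum>k=1..K. ennreal h * ennreal (P (real k * h)))"
      using h by (simp add: sum_distrib_left P_def ennreal_mult flip: sum_ennreal)
    also have "\<dots> = (\<Sum>k=1..K. \<integral>\<^sup>+\<omega>. ennreal h * indicator {\<omega> \<in> space M. X (real k * h) \<omega> \<noteq> Y (real k * h) \<omega>} \<omega> \<partial>M)"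
    proof (rule sum.cong[OF refl])
      fix k
      have "{\<omega> \<in> space M. X (real k * h) \<omega> \<noteq> Y (real k * h) \<omega>} \<in> events"
        using sets_Z[of "real k * h" "\<lambda>z. fst z \<noteq> snd z"] h by simp
      then show "ennreal h * ennreal (P (real k * h)) =
          (\<integral>\<^sup>+\<omega>. ennreal h * indicator {\<omega> \<in> space M. X (real k * h) \<omega> \<noteq> Y (real k * h) \<omega>} \<omega> \<partial>M)"
        by (simp add: nn_integral_cmult_indicator P_def emeasure_eq_measure)
    qed
    also have "\<dots> = (\<integral>\<^sup>+\<omega>. (\<Sum>k=1..K. ennreal h * indicator {\<omega> \<in> space M. X (real k * h) \<omega> \<noteq> Y (real k * h) \<omega>} \<omega>) \<partial>M)"
    proof (rule nn_integral_sum[symmetric])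
      fix k
      have "{\<omega> \<in> space M. X (real k * h) \<omega> \<noteq> Y (real k * h) \<omega>} \<in> events"
        using sets_Z[of "real k * h" "\<lambda>z. fst z \<noteq> snd z"] h by simp
      then show "(\<lambda>\<omega>. ennreal h * indicator {\<omega> \<in> space M. X (real k * h) \<omega> \<noteq> Y (real k * h) \<omega>} \<omega>) \<in> borel_measurable M"
        by measurable
    qed
    also have "\<dots> \<le> (\<integral>\<^sup>+\<omega>. coupling_time X Y \<omega> \<partial>M)"
    proof (rule nn_integral_mono)
      fix \<omega> assume "\<omega> \<in> space M"
      then show "(\<Sum>k=1..K. ennreal h * indicator {\<omega> \<in> space M. X (real k * h) \<omega> \<noteq> Y (real k * h) \<omega>} \<omega>) \<le> coupling_time X Y \<omega>"
        using time_apart_le_coupling_time[OF h, where K = K and X = X and Y = Y and \<omega> = \<omega>] by (simp add: indicator_def of_bool_def)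
    qed
    finally show ?thesis
      using real by simp
  qed
  have bound: "expect 0 F \<le> (1 + \<epsilon>) * (\<epsilon> + T)" if \<epsilon>: "\<epsilon> > 0" for \<epsilon>
  proof -
    have "\<forall>\<^sub>F h in at_right 0. \<forall>s\<ge>0.
        expect s F - h * (1 + \<epsilon>) * prob {\<omega> \<in> space M. fst (X s \<omega>, Y s \<omega>) \<noteq> snd (X s \<omega>, Y s \<omega>)} \<le> expect (s + h) F"
      by (rule expect_step_ge[OF nonneg _ _ \<epsilon>]) (auto simp: zero gen)
    then have "\<forall>\<^sub>F h in at_right 0. \<forall>s\<ge>0. expect s F - h * (1 + \<epsilon>) * P s \<le> expect (s + h) F"
      by (simp add: P_def)
    then have "\<forall>\<^sub>F h in at_right 0. 0 < h \<and> h < \<epsilon> \<and> (\<forall>s\<ge>0. expect s F - h * (1 + \<epsilon>) * P s \<le> expect (s + h) F)"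
      using eventually_at_right_less[of "0 :: real"] eventually_at_right_real[OF \<epsilon>]
      by eventually_elim auto
    then obtain h where h: "0 < h" "h < \<epsilon>" "\<And>s. s \<ge> 0 \<Longrightarrow> expect s F - h * (1 + \<epsilon>) * P s \<le> expect (s + h) F"
      using eventually_happens[of _ "at_right (0 :: real)"] by auto
    have "expect 0 F \<le> expect (real K * h) F + h * (1 + \<epsilon>) * (\<Sum>k<K. P (real k * h))" for K
    proof (induction K)
      case (Suc K)
      then show ?case
        using h(3)[of "real K * h"] h(1) by (simp add: algebra_simps)
    qed simp
    \<comment> \<open>The one-step estimates use grid indices 0 to \<open>K - 1\<close>, the
      pathwise bound uses 1 to \<open>K\<close>; the exchange costs one mesh, which is below
      \<open>\<epsilon>\<close>.\<close>
    moreover have "(\<Sum>k<K. P (real k * h)) \<le> 1 + (\<Sum>k=1..K. P (real k * h))" for K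
    proof -
      have "(\<Sum>k<K. P (real k * h)) \<le> (\<Sum>k\<in>insert 0 {1..K}. P (real k * h))"
        by (rule sum_mono2) (auto simp: P_def)
      also have "\<dots> \<le> 1 + (\<Sum>k=1..K. P (real k * h))"
        by (simp add: P_def)
      finally show ?thesis .
    qed
    then have "h * (1 + \<epsilon>) * (\<Sum>k<K. P (real k * h)) \<le> h * (1 + \<epsilon>) * (1 + (\<Sum>k=1..K. P (real k * h)))" for K
      using h \<epsilon> by (intro mult_left_mono) auto
    moreover have "h * (1 + \<epsilon>) * (1 + (\<Sum>k=1..K. P (real k * h))) = (1 + \<epsilon>) * (h + h * (\<Sum>k=1..K. P (real k * h)))" for K
      by (simp add: algebra_simps)
    moreover have "(1 + \<epsilon>) * (h + h * (\<Sum>k=1..K. P (real k * h))) \<le> (1 + \<epsilon>) * (\<epsilon> + T)" for K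
      using sum_le[OF h(1), of K] h \<epsilon> by (intro mult_left_mono add_mono) auto
    moreover have "expect (real K * h) F \<le> C * P (real K * h)" for K
      using expect_le h by simp
    ultimately have *: "expect 0 F \<le> C * P (real K * h) + (1 + \<epsilon>) * (\<epsilon> + T)" for K
      by (smt (verit, best))
    have "summable (\<lambda>k. P (real (Suc k) * h))"
    proof (rule summableI_nonneg_bounded)
      fix K
      have "(\<Sum>k<K. P (real (Suc k) * h)) = (\<Sum>k=1..K. P (real k * h))"
        by (rule sum.reindex_bij_witness[of _ "\<lambda>k. k - 1" Suc]) auto
      then show "(\<Sum>k<K. P (real (Suc k) * h)) \<le> T / h"
        using sum_le[OF h(1), of K] h(1) by (simp add: field_simps)
    qed (simp add: P_def)
    then have "(\<lambda>K. P (real (Suc K) * h)) \<longlonglongrightarrow> 0"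
      by (rule summable_LIMSEQ_zero)
    then have "(\<lambda>K. C * P (real (Suc K) * h) + (1 + \<epsilon>) * (\<epsilon> + T)) \<longlonglongrightarrow> C * 0 + (1 + \<epsilon>) * (\<epsilon> + T)"
      by (intro tendsto_intros)
    from LIMSEQ_le_const[OF this] * have "expect 0 F \<le> C * 0 + (1 + \<epsilon>) * (\<epsilon> + T)"
      by blast
    then show ?thesis by simp
  qed
  have "((\<lambda>\<epsilon>. (1 + \<epsilon>) * (\<epsilon> + T)) \<longlongrightarrow> (1 + 0) * (0 + T)) (at_right 0)"
    by (intro tendsto_intros)
  moreover have "\<forall>\<^sub>F \<epsilon> in at_right 0. expect 0 F \<le> (1 + \<epsilon>) * (\<epsilon> + T)"
    using eventually_at_right_less[of 0] by eventually_elim (rule bound)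
  ultimately have "expect 0 F \<le> (1 + 0) * (0 + T)"
    by (intro tendsto_lowerbound) auto
  then show ?thesis
    using real by (simp add: expect_def initial ennreal_leI)
qed simp


section \<open>The coupling with rates q-hat\<close>

lemma upd_in_vertices: "x \<in> vertices n d \<Longrightarrow> i < d \<Longrightarrow> k < n \<Longrightarrow> x(i := k) \<in> vertices n d"
  by (auto simp: vertices_def PiE_iff extensional_def)

section \<open>Double stochasticity of q-hat\<close>

lemma qhat_eq:
  assumes U: "U = unmatched d x y"
  shows "qhat n d x y (i, k) (j, l) =
    (if i \<in> U \<and> paired_regime n (card U)
     then if i \<noteq> j then (if j \<in> U \<and> k = y i \<and> l = x j then 1 / (real (card U) - 1) else 0)
       else if l = k \<and> k \<noteq> x i \<and> k \<noteq> y i \<or> k = x i \<and> l = y i then 1 else 0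
     else if j = i \<and> l = k then 1 else 0)"
proof -
  define P where "P \<longleftrightarrow> i \<in> U \<and> paired_regime n (card U)"
  have neq: "P \<Longrightarrow> x i \<noteq> y i"
    using U by (simp add: P_def unmatched_def)
  have unfolded: "qhat n d x y (i, k) (j, l) =
    (if P then
       if j \<in> U \<and> i \<noteq> j then (if k = y i \<and> l = x j then 1 / (real (card U) - 1) else 0)
       else if j = i \<and> l = k then (if k \<noteq> x i \<and> k \<noteq> y i then 1 else 0)
       else if j = i \<and> k = x i \<and> l = y i then 1
       else 0
     else if j = i \<and> l = k then 1
     else 0)"
    by (simp only: qhat_def Let_def prod.case U P_def)
  show ?thesis
    unfolding unfolded P_def[symmetric] using neq by (cases P; cases "i = j") simp_all
qed

text \<open>Exchanging the two walks transposes the matrix, so column sums reduce to row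
  sums.\<close>

lemma qhat_swap: "qhat n d x y (i, k) (j, l) = qhat n d y x (j, l) (i, k)"
proof -
  define U where "U = unmatched d x y"
  have U': "U = unmatched d y x"
    by (auto simp: U_def unmatched_def)
  have neq: "i \<in> U \<Longrightarrow> x i \<noteq> y i"
    by (simp add: U_def unmatched_def)
  show ?thesis
    unfolding qhat_eq[OF U_def] qhat_eq[OF U']
    using neq by (cases "i = j") (simp_all add: conj_ac)
qed
text \<open>Keeps the pairing weight \<open>1 / (N - 1)\<close> from dividing by 0. For odd
  \<open>N\<close> the threshold itself lies above 2.\<close>

lemma paired_card_ge_2:
  assumes "paired_regime n N" "N \<ge> 1"
  shows "N \<ge> 2"
proof (cases "even N")
  case True
  then show ?thesis using assms by (auto elim!: evenE)
next
  case False
  then have "n > 2" "real N \<ge> 2 * (real n - 1) / (real n - 2)"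
    using assms by (auto simp: paired_regime_def)
  moreover from this have "2 * (real n - 1) / (real n - 2) \<ge> 2"
    by (simp add: field_simps)
  ultimately show ?thesis by linarith
qed

text \<open>Several pairs of assignments may lead to the same state, so \<open>hat_rate\<close> sums
  over fibres; summing over target states undoes this.\<close>

lemma sum_hat_rate:
  fixes F :: "(nat \<Rightarrow> nat) \<times> (nat \<Rightarrow> nat) \<Rightarrow> real"
  assumes "x \<in> vertices n d" "y \<in> vertices n d"
  shows "(\<Sum>z\<in>vertices n d \<times> vertices n d. hat_rate n d (x, y) z * F z) =
    (\<Sum>(i, k)\<in>{..<d} \<times> {..<n}. \<Sum>(j, l)\<in>{..<d} \<times> {..<n}.
      qhat n d x y (i, k) (j, l) / (real n - 1) * F (x(i := k), y(j := l)))"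
proof -
  let ?S = "vertices n d \<times> vertices n d" and ?I = "{..<d} \<times> {..<n}"
  have "(\<Sum>z\<in>?S. hat_rate n d (x, y) z * F z) =
      (\<Sum>z\<in>?S. \<Sum>a\<in>?I. \<Sum>b\<in>?I. (if (x(fst a := snd a), y(fst b := snd b)) = z
        then qhat n d x y a b / (real n - 1) * F z else 0))"
    by (simp add: hat_rate_def case_prod_unfold sum_distrib_right if_distrib[of "\<lambda>a. a * _"] cong: if_cong)
  also have "\<dots> = (\<Sum>a\<in>?I. \<Sum>b\<in>?I. \<Sum>z\<in>?S. (if (x(fst a := snd a), y(fst b := snd b)) = z
        then qhat n d x y a b / (real n - 1) * F z else 0))"
    by (subst sum.swap, rule sum.cong[OF refl], rule sum.swap)
  also have "\<dots> = (\<Sum>a\<in>?I. \<Sum>b\<in>?I. qhat n d x y a b / (real n - 1) * F (x(fst a := snd a), y(fst b := snd b)))"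
    using assms by (intro sum.cong refl) (auto simp: sum.delta upd_in_vertices)
  finally show ?thesis
    by (simp add: case_prod_unfold)
qed

text \<open>In the paired regime the row of an unmatched \<open>i\<close> with
  \<open>k = y i\<close> spreads its mass evenly over the \<open>N - 1\<close> other unmatched
  coordinates; every other row has a single entry 1.\<close>

lemma sum_qhat_row:
  assumes n: "n \<ge> 2" and ik: "i < d" "k < n" and xy: "x \<in> vertices n d" "y \<in> vertices n d"
  shows "(\<Sum>(j, l)\<in>{..<d} \<times> {..<n}. qhat n d x y (i, k) (j, l)) = 1"
proof -
  let ?I = "{..<d} \<times> {..<n}"
  define U where "U = unmatched d x y"
  have U: "finite U" "U \<subseteq> {..<d}"
    by (auto simp: U_def unmatched_def)
  have x: "x j < n" "y j < n" if "j < d" for j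
    using that xy by (auto intro: coordinate_in_vertices)
  have single: "(\<Sum>(j, l)\<in>?I. qhat n d x y (i, k) (j, l)) = 1"
    if "\<And>j l. j < d \<Longrightarrow> qhat n d x y (i, k) (j, l) = of_bool (j = i \<and> l = m)" "m < n" for m
  proof -
    have "(\<Sum>(j, l)\<in>?I. qhat n d x y (i, k) (j, l)) = (\<Sum>b\<in>?I. if b = (i, m) then 1 else 0)"
      using that(1) by (intro sum.cong) auto
    then show ?thesis
      using that(2) ik by (simp add: sum.delta)
  qed
  show ?thesis
  proof (cases "i \<in> U \<and> paired_regime n (card U)")
    case False
    then show ?thesis
      using ik by (intro single[of k]) (auto simp: qhat_eq[OF U_def])
  next
    case True
    then have "card U \<ge> 1"
      using U by (metis One_nat_def Suc_leI card_gt_0_iff empty_iff)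
    then have N: "card U \<ge> 2"
      using True by (intro paired_card_ge_2) auto
    have neq: "x i \<noteq> y i"
      using True by (simp add: U_def unmatched_def)
    show ?thesis
    proof (cases "k = y i")
      case False
      \<comment> \<open>The row \<open>k = x i\<close> has its entry at \<open>l = y i\<close>, the
        idle move; in the remaining rows the second walk copies \<open>k\<close>.\<close>
      then show ?thesis
        using True neq ik x[of i]
        by (intro single[of "if k = x i then y i else k"]) (auto simp: qhat_eq[OF U_def])
    next
      case k: True
      have "(\<Sum>(j, l)\<in>?I. qhat n d x y (i, k) (j, l)) = (\<Sum>j<d. \<Sum>l<n. qhat n d x y (i, k) (j, l))"
        by (simp add: sum.cartesian_product)
      also have "\<dots> = (\<Sum>j<d. if j \<in> U - {i} then 1 / (real (card U) - 1) else 0)"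
      proof (rule sum.cong[OF refl])
        fix j assume j: "j \<in> {..<d}"
        define R where "R \<longleftrightarrow> j \<in> U - {i}"
        have "qhat n d x y (i, k) (j, l) = (if R then (if l = x j then 1 / (real (card U) - 1) else 0) else 0)" for l
          using True neq neq[symmetric] by (cases "i = j") (simp_all add: qhat_eq[OF U_def] k R_def)
        then show "(\<Sum>l<n. qhat n d x y (i, k) (j, l)) = (if j \<in> U - {i} then 1 / (real (card U) - 1) else 0)"
          unfolding R_def[symmetric] using x[of j] j by (cases R) (simp_all add: sum.delta)
      qed
      also have "\<dots> = (\<Sum>j\<in>U - {i}. 1 / (real (card U) - 1))"
      proof -
        have "{j \<in> {..<d}. j \<in> U - {i}} = U - {i}" using U by auto
        then show ?thesis by (subst sum.inter_filter[symmetric]) simp_all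
      qed
      also have "\<dots> = 1"
        using True U N by (simp add: of_nat_diff)
      finally show ?thesis .
    qed
  qed
qed

lemma sum_qhat_column:
  assumes n: "n \<ge> 2" and jl: "j < d" "l < n" and xy: "x \<in> vertices n d" "y \<in> vertices n d"
  shows "(\<Sum>(i, k)\<in>{..<d} \<times> {..<n}. qhat n d x y (i, k) (j, l)) = 1"
  using sum_qhat_row[OF n jl xy(2,1)] by (simp add: qhat_swap[of n d x y])

section \<open>Eigenfunctions of the marginal generators\<close>

text \<open>These products are the eigenfunctions of the walk; indicators of states are combinations of them.\<close>

definition coord_dev :: "nat \<Rightarrow> nat set \<Rightarrow> (nat \<Rightarrow> nat) \<Rightarrow> (nat \<Rightarrow> nat) \<Rightarrow> real" where
  "coord_dev n A c x = (\<Prod>i\<in>A. of_bool (x i = c i) - 1 / n)"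

text \<open>Running through all \<open>n\<close> values of coordinate \<open>i\<close> averages its
  centred factor to 0, so each \<open>i\<close> in \<open>A\<close> contributes
  \<open>- n / (n - 1)\<close> times the product, and coordinates outside \<open>A\<close>
  contribute nothing.\<close>

lemma sum_coord_dev_upd:
  assumes n: "n \<ge> 2" and A: "A \<subseteq> {..<d}" and c: "\<And>i. i < d \<Longrightarrow> c i < n"
  shows "(\<Sum>(i, k)\<in>{..<d} \<times> {..<n}. (coord_dev n A c (x(i := k)) - coord_dev n A c x) / (real n - 1)) =
    - (card A * (n / (real n - 1))) * coord_dev n A c x"
proof -
  have fin: "finite A"
    using A finite_subset by blast
  have sum_k: "(\<Sum>k<n. coord_dev n A c (x(i := k)) - coord_dev n A c x) = (if i \<in> A then - n * coord_dev n A c x else 0)"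
    if "i < d" for i
  proof (cases "i \<in> A")
    case True
    have "coord_dev n A c (x(i := k)) = (of_bool (k = c i) - 1 / n) * (\<Prod>j\<in>A - {i}. of_bool (x j = c j) - 1 / n)" for k
      unfolding coord_dev_def using fin True by (subst prod.remove[of A i]) (auto intro!: prod.cong)
    then have "(\<Sum>k<n. coord_dev n A c (x(i := k))) =
        (\<Sum>k<n. of_bool (k = c i) - 1 / n) * (\<Prod>j\<in>A - {i}. of_bool (x j = c j) - 1 / n)"
      by (simp only: sum_distrib_right)
    also have "(\<Sum>k<n. of_bool (k = c i) - 1 / n :: real) = 0"
      using n c[OF that] by (simp add: sum_subtractf of_bool_def sum.delta)
    finally have "(\<Sum>k<n. coord_dev n A c (x(i := k))) = 0"
      by (simp only: mult_zero_left)
    then show ?thesis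
      using True by (simp only: sum_subtractf) simp
  next
    case False
    then have "coord_dev n A c (x(i := k)) = coord_dev n A c x" for k
      unfolding coord_dev_def by (intro prod.cong) auto
    then show ?thesis
      using False by simp
  qed
  have "(\<Sum>(i, k)\<in>{..<d} \<times> {..<n}. (coord_dev n A c (x(i := k)) - coord_dev n A c x) / (real n - 1)) =
      (\<Sum>i<d. (\<Sum>k<n. coord_dev n A c (x(i := k)) - coord_dev n A c x) / (real n - 1))"
    by (simp add: sum.cartesian_product[symmetric] sum_divide_distrib)
  also have "\<dots> = (\<Sum>i<d. if i \<in> A then - n * coord_dev n A c x / (real n - 1) else 0)"
    using sum_k by (intro sum.cong) auto
  also have "\<dots> = card A * (- n * coord_dev n A c x / (real n - 1))"
    using A fin by (subst sum.inter_filter[symmetric]) (auto simp: Int_absorb1 Collect_conj_eq[symmetric] intro!: arg_cong[where f = card])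
  finally show ?thesis
    by simp
qed

text \<open>Unit row sums of q-hat make its generator act on functions of the first walk like that
  of a single walk; unit column sums do the same for the second.\<close>

lemma hat_gen_coord_dev:
  assumes n: "n \<ge> 2" and A: "A \<subseteq> {..<d}" and c: "\<And>i. i < d \<Longrightarrow> c i < n"
    and xy: "x \<in> vertices n d" "y \<in> vertices n d"
  shows "(\<Sum>z\<in>vertices n d \<times> vertices n d. hat_rate n d (x, y) z * (coord_dev n A c (fst z) - coord_dev n A c x)) =
      - (card A * (n / (real n - 1))) * coord_dev n A c x" (is ?fst)
    and "(\<Sum>z\<in>vertices n d \<times> vertices n d. hat_rate n d (x, y) z * (coord_dev n A c (snd z) - coord_dev n A c y)) =
      - (card A * (n / (real n - 1))) * coord_dev n A c y" (is ?snd)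
proof -
  let ?I = "{..<d} \<times> {..<n}"
  have "(\<Sum>z\<in>vertices n d \<times> vertices n d. hat_rate n d (x, y) z * (coord_dev n A c (fst z) - coord_dev n A c x)) =
      (\<Sum>(i, k)\<in>?I. (\<Sum>(j, l)\<in>?I. qhat n d x y (i, k) (j, l)) * ((coord_dev n A c (x(i := k)) - coord_dev n A c x) / (real n - 1)))"
    by (simp add: sum_hat_rate[OF xy] sum_distrib_right sum_divide_distrib case_prod_unfold)
  also have "\<dots> = (\<Sum>(i, k)\<in>?I. (coord_dev n A c (x(i := k)) - coord_dev n A c x) / (real n - 1))"
    using sum_qhat_row[OF n _ _ xy] by (intro sum.cong) auto
  finally show ?fst
    by (simp only: sum_coord_dev_upd[OF n A c])
  have "(\<Sum>z\<in>vertices n d \<times> vertices n d. hat_rate n d (x, y) z * (coord_dev n A c (snd z) - coord_dev n A c y)) =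
      (\<Sum>a\<in>?I. \<Sum>b\<in>?I. qhat n d x y a b * ((coord_dev n A c (y(fst b := snd b)) - coord_dev n A c y) / (real n - 1)))"
    by (simp add: sum_hat_rate[OF xy] case_prod_unfold)
  also have "\<dots> = (\<Sum>b\<in>?I. (\<Sum>a\<in>?I. qhat n d x y a b) * ((coord_dev n A c (y(fst b := snd b)) - coord_dev n A c y) / (real n - 1)))"
    by (subst sum.swap) (simp only: sum_distrib_right)
  also have "\<dots> = (\<Sum>b\<in>?I. (coord_dev n A c (y(fst b := snd b)) - coord_dev n A c y) / (real n - 1))"
    using sum_qhat_column[OF n _ _ xy] by (intro sum.cong) (auto simp: case_prod_unfold)
  finally show ?snd
    using sum_coord_dev_upd[where c = c and x = y, OF n A c] by (simp add: case_prod_unfold)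
qed

section \<open>Drift of the number of unmatched coordinates\<close>

text \<open>The increments \<open>1 / (N + 1)\<close> are chosen so that the drift \<open>- N * n / (n - 1)\<close> of the number of unmatched
  coordinates decreases this function at rate at most 1, also when two coordinates merge at once.\<close>

definition merging_bound :: "nat \<Rightarrow> nat \<Rightarrow> real" where
  "merging_bound n N = (real n - 1) / n * (harm (Suc N) - 1)"

lemma merging_bound_diff:
  assumes "n \<ge> 2" "N \<ge> 1"
  shows "merging_bound n N - merging_bound n (N - 1) \<le> (real n - 1) / n / N"
proof -
  obtain m where m: "N = Suc m"
    using assms(2) by (cases N) auto
  have "harm (Suc N) - harm (Suc m) = 1 / (real N + 1)"
    by (simp add: m harm_Suc inverse_eq_divide add_ac)
  also have "\<dots> \<le> 1 / N"
    using m by (intro divide_left_mono) auto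
  finally have "(real n - 1) / n * (harm (Suc N) - harm (Suc m)) \<le> (real n - 1) / n * (1 / N)"
    using assms by (intro mult_left_mono) auto
  then show ?thesis
    by (simp add: merging_bound_def m right_diff_distrib)
qed

text \<open>Here the shift in \<open>harm (Suc N)\<close> matters: a double merge costs
  \<open>1 / (N + 1) + 1 / N\<close>, at most \<open>2 / N\<close>, whereas unshifted harmonic
  numbers would cost \<open>1 / N + 1 / (N - 1)\<close>, which is more.\<close>

lemma merging_bound_diff2:
  assumes "n \<ge> 2" "N \<ge> 2"
  shows "merging_bound n N - merging_bound n (N - 2) \<le> (real n - 1) / n * 2 / N"
proof -
  obtain m where m: "N = Suc (Suc m)"
    using assms(2) by (metis One_nat_def Suc_1 Suc_le_D Suc_le_mono)
  have "harm (Suc N) - harm (Suc m) = 1 / (real N + 1) + 1 / real N"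
    by (simp add: m harm_Suc inverse_eq_divide add_ac)
  also have "\<dots> \<le> 1 / N + 1 / N"
    using m by (intro add_right_mono divide_left_mono) auto
  finally have "(real n - 1) / n * (harm (Suc N) - harm (Suc m)) \<le> (real n - 1) / n * (2 / N)"
    using assms by (intro mult_left_mono) auto
  then show ?thesis
    by (simp add: merging_bound_def m right_diff_distrib)
qed

text \<open>The loss is charged to the assignment in the first walk. In the paired regime
  \<open>k = y i\<close> merges two coordinates and costs up to \<open>2 * b\<close>, but
  \<open>k = x i\<close> changes nothing. So each unmatched \<open>i\<close> costs at most
  \<open>n * b\<close> in either regime, and \<open>N * (n * b) / (n - 1) = 1\<close>.\<close>

lemma hat_gen_merging_bound:
  assumes n: "n \<ge> 2" and xy: "x \<in> vertices n d" "y \<in> vertices n d" and neq: "x \<noteq> y"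
  defines "F z \<equiv> merging_bound n (card (unmatched d (fst z) (snd z)))"
  shows "(\<Sum>z\<in>vertices n d \<times> vertices n d. hat_rate n d (x, y) z * (F z - F (x, y))) \<ge> - 1"
proof -
  let ?I = "{..<d} \<times> {..<n}"
  define U where "U = unmatched d x y"
  define N where "N = card U"
  define b where "b = (real n - 1) / n / N"
  have U: "finite U" "U \<subseteq> {..<d}"
    by (auto simp: U_def unmatched_def)
  have "U \<noteq> {}"
    using vertices_eqI[OF xy] neq by (auto simp: U_def unmatched_def)
  then have N: "N \<ge> 1"
    using U by (simp add: N_def Suc_le_eq card_gt_0_iff)
  have b: "b \<ge> 0" using n by (simp add: b_def)
  define D where "D a b' = F (x, y) - F (x(fst a := snd a), y(fst b' := snd b'))" for a b'
  have D_eq: "D a b' = merging_bound n N - merging_bound n (card (unmatched d (x(fst a := snd a)) (y(fst b' := snd b'))))" for a b'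
    by (simp add: D_def F_def N_def U_def)
  define w where "w i k = (if i \<notin> U \<or> (paired_regime n N \<and> k = x i) then 0 else if paired_regime n N \<and> k = y i then 2 * b else b)" for i k
  have D_le: "D (i, k) (j, l) \<le> w i k" if ij: "i < d" "j < d" and nz: "qhat n d x y (i, k) (j, l) \<noteq> 0" for i k j l
  proof (cases "i \<in> U \<and> paired_regime n N")
    case False
    then have jl: "j = i" "l = k"
      using nz by (auto simp: qhat_eq[OF U_def] N_def split: if_splits)
    have "unmatched d (x(i := k)) (y(i := k)) = U - {i}"
      by (auto simp: unmatched_def U_def)
    then show ?thesis
      using False jl merging_bound_diff[OF n N] U by (auto simp: D_eq w_def N_def b_def)
  next
    case True
    have neq: "x i \<noteq> y i"
      using True by (simp add: U_def unmatched_def)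
    consider "j \<in> U" "i \<noteq> j" "k = y i" "l = x j" | "j = i" "l = k" "k \<noteq> x i" "k \<noteq> y i" | "j = i" "k = x i" "l = y i"
      using nz True unfolding qhat_eq[OF U_def] N_def[symmetric] by (cases "i = j") (auto split: if_splits)
    then show ?thesis
    proof cases
      case 1
      have "unmatched d (x(i := k)) (y(j := l)) = U - {i, j}"
        using 1 by (auto simp: unmatched_def U_def)
      moreover have "card (U - {i, j}) = N - 2"
        using 1 True U by (simp add: N_def card_Diff_subset)
      ultimately have "D (i, k) (j, l) = merging_bound n N - merging_bound n (N - 2)"
        by (simp only: D_eq fst_conv snd_conv)
      also have "\<dots> \<le> (real n - 1) / n * 2 / N"
        using True N by (intro merging_bound_diff2[OF n] paired_card_ge_2) auto
      also have "\<dots> = w i k"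
        using 1(3) True neq by (simp add: w_def b_def)
      finally show ?thesis .
    next
      case 2
      have "unmatched d (x(i := k)) (y(j := l)) = U - {i}"
        using 2 by (auto simp: unmatched_def U_def)
      moreover have "card (U - {i}) = N - 1"
        using True U by (simp add: N_def)
      ultimately have "D (i, k) (j, l) = merging_bound n N - merging_bound n (N - 1)"
        by (simp only: D_eq fst_conv snd_conv)
      also have "\<dots> \<le> (real n - 1) / n / N"
        by (rule merging_bound_diff[OF n N])
      also have "\<dots> = w i k"
        using 2(3,4) True by (simp add: w_def b_def)
      finally show ?thesis .
    next
      case 3
      then have "x(i := k) = x" "y(j := l) = y" by auto
      then show ?thesis
        using 3 True by (simp add: D_eq w_def N_def U_def)
    qed
  qed
  have q: "qhat n d x y (i, k) (j, l) \<ge> 0" for i k j l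
  proof -
    define c where "c = 1 / (real N - 1)"
    have "c \<ge> 0" using N by (simp add: c_def)
    then have "0 \<le> (if P then if Q then if R then c else 0 else if R' then 1 else 0 else if Q' then 1 else 0)" for P Q R R' Q'
      by simp
    then show ?thesis
      unfolding qhat_eq[OF U_def] N_def[symmetric] c_def[symmetric] by blast
  qed
  have sum_w: "(\<Sum>k<n. w i k) \<le> (if i \<in> U then n * b else 0)" if "i < d" for i
  proof (cases "i \<in> U \<and> paired_regime n N")
    case True
    have neq: "x i \<noteq> y i"
      using True by (simp add: U_def unmatched_def)
    have "w i k = b + (of_bool (k = y i) * b - of_bool (k = x i) * b)" for k
      using True neq by (auto simp: w_def)
    then have "(\<Sum>k<n. w i k) = n * b"
      using coordinate_in_vertices[OF xy(1) that] coordinate_in_vertices[OF xy(2) that]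
      by (simp add: sum.distrib sum_subtractf of_bool_def if_distrib[of "\<lambda>a. a * b"] sum.delta cong: if_cong)
    then show ?thesis using True by simp
  next
    case False
    then have "w i k = (if i \<in> U then b else 0)" for k
      by (auto simp: w_def)
    then show ?thesis by simp
  qed
  have "- (\<Sum>z\<in>vertices n d \<times> vertices n d. hat_rate n d (x, y) z * (F z - F (x, y))) =
      (\<Sum>z\<in>vertices n d \<times> vertices n d. hat_rate n d (x, y) z * (F (x, y) - F z))"
    by (simp only: sum_negf[symmetric] mult_minus_right[symmetric] minus_diff_eq)
  also have "\<dots> = (\<Sum>(i, k)\<in>?I. \<Sum>(j, l)\<in>?I. qhat n d x y (i, k) (j, l) / (real n - 1) * D (i, k) (j, l))"
    by (simp only: sum_hat_rate[OF xy] D_def fst_conv snd_conv)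
  also have "\<dots> \<le> (\<Sum>(i, k)\<in>?I. \<Sum>(j, l)\<in>?I. qhat n d x y (i, k) (j, l) / (real n - 1) * w i k)"
    unfolding case_prod_unfold
  proof (intro sum_mono)
    fix a c assume "a \<in> ?I" "c \<in> ?I"
    then have a: "fst a < d" and c: "fst c < d" by auto
    let ?q = "qhat n d x y (fst a, snd a) (fst c, snd c)"
    show "?q / (real n - 1) * D (fst a, snd a) (fst c, snd c) \<le> ?q / (real n - 1) * w (fst a) (snd a)"
    proof (cases "?q = 0")
      case False
      then show ?thesis
        using D_le[OF a c False] n by (intro mult_left_mono divide_nonneg_nonneg q) auto
    qed simp
  qed
  also have "\<dots> = (\<Sum>(i, k)\<in>?I. (\<Sum>(j, l)\<in>?I. qhat n d x y (i, k) (j, l)) * (w i k / (real n - 1)))"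
    by (simp add: sum_distrib_right sum_divide_distrib case_prod_unfold)
  also have "\<dots> = (\<Sum>(i, k)\<in>?I. w i k / (real n - 1))"
    using sum_qhat_row[OF n _ _ xy] by (intro sum.cong) auto
  also have "\<dots> = (\<Sum>i<d. \<Sum>k<n. w i k) / (real n - 1)"
    by (simp add: sum.cartesian_product sum_divide_distrib case_prod_unfold)
  also have "\<dots> \<le> (\<Sum>i<d. if i \<in> U then n * b else 0) / (real n - 1)"
    using sum_w n by (intro divide_right_mono sum_mono) auto
  also have "(\<Sum>i<d. if i \<in> U then n * b else 0) = N * (n * b)"
  proof -
    have "{i \<in> {..<d}. i \<in> U} = U" using U by auto
    then show ?thesis
      by (subst sum.inter_filter[symmetric]) (auto simp: N_def)
  qed
  also have "N * (n * b) / (real n - 1) = 1"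
    using n N by (simp add: b_def)
  finally show ?thesis by simp
qed

section \<open>Single-time laws of the coupling and the bound under maximality\<close>

lemma hat_couplingD:
  assumes "hat_coupling n d M X Y"
  obtains p where "markov_jump M (vertices n d \<times> vertices n d) (hat_rate n d)
    (map_pmf (\<lambda>y. (origin d, y)) (pmf_of_set (vertices n d))) (\<lambda>t \<omega>. (X t \<omega>, Y t \<omega>)) p"
proof -
  let ?S = "vertices n d \<times> vertices n d" and ?Z = "\<lambda>t \<omega>. (X t \<omega>, Y t \<omega>)"
  from assms obtain p where p: "process M ?S ?Z" "transition_semigroup ?S (hat_rate n d) p"
    "\<forall>z\<in>?S. measure M {\<omega> \<in> space M. ?Z 0 \<omega> = z} =
      pmf (map_pmf (\<lambda>y. (origin d, y)) (pmf_of_set (vertices n d))) z"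
    "\<forall>(m :: nat) u z. 0 \<le> u 0 \<longrightarrow> (\<forall>i\<le>m. u i \<le> u (Suc i)) \<longrightarrow> (\<forall>i\<le>Suc m. z i \<in> ?S) \<longrightarrow>
      measure M {\<omega> \<in> space M. \<forall>i\<le>Suc m. ?Z (u i) \<omega> = z i} =
      measure M {\<omega> \<in> space M. \<forall>i\<le>m. ?Z (u i) \<omega> = z i} * pmf (p (u (Suc m) - u m) (z m)) (z (Suc m))"
    unfolding hat_coupling_def markov_jump_process_def by blast
  interpret prob_space M
    using p(1) by (simp add: process_def)
  have "markov_jump M ?S (hat_rate n d)
    (map_pmf (\<lambda>y. (origin d, y)) (pmf_of_set (vertices n d))) ?Z p"
    by (unfold_locales) (use p in \<open>blast | simp\<close>)+
  then show ?thesis by (rule that)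
qed

lemma process_fst_snd:
  assumes "process M (V \<times> W) (\<lambda>t \<omega>. (X t \<omega>, Y t \<omega>))"
  shows "process M V X" "process M W Y"
proof -
  have Z: "(\<lambda>\<omega>. (X t \<omega>, Y t \<omega>)) \<in> M \<rightarrow>\<^sub>M count_space (V \<times> W)" if "t \<ge> 0" for t
    using assms that by (simp add: process_def)
  have "X t \<in> M \<rightarrow>\<^sub>M count_space V" "Y t \<in> M \<rightarrow>\<^sub>M count_space W" if "t \<ge> 0" for t
    using measurable_compose[OF Z[OF that], of fst "count_space V"]
      measurable_compose[OF Z[OF that], of snd "count_space W"]
    by (auto simp: Pi_iff)
  moreover have "\<forall>\<^sub>F s in at_right t. X s \<omega> = X t \<omega>" "\<forall>\<^sub>F s in at_right t. Y s \<omega> = Y t \<omega>"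
    if "\<omega> \<in> space M" "t \<ge> 0" for t \<omega>
  proof -
    have "\<forall>\<^sub>F s in at_right t. (X s \<omega>, Y s \<omega>) = (X t \<omega>, Y t \<omega>)"
      using assms that by (simp add: process_def)
    then show "\<forall>\<^sub>F s in at_right t. X s \<omega> = X t \<omega>" "\<forall>\<^sub>F s in at_right t. Y s \<omega> = Y t \<omega>"
      by (auto elim: eventually_mono)
  qed
  ultimately show "process M V X" "process M W Y"
    using assms by (simp_all add: process_def)
qed

lemma prod_of_bool: "finite A \<Longrightarrow> (\<Prod>i\<in>A. of_bool (P i)) = (of_bool (\<forall>i\<in>A. P i) :: real)"
  by (induction A rule: finite_induct) auto

text \<open>Each coordinate indicator is its centred part plus \<open>1 / n\<close>; expand the
  product.\<close>

lemma of_bool_eq_sum_coord_dev: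
  assumes "x \<in> vertices n d" "c \<in> vertices n d"
  shows "of_bool (x = c) = (\<Sum>A\<in>Pow {..<d}. (1 / n) ^ card ({..<d} - A) * coord_dev n A c x)"
proof -
  have "of_bool (x = c) = (of_bool (\<forall>i\<in>{..<d}. x i = c i) :: real)"
    using vertices_eqI[OF assms] by auto
  also have "\<dots> = (\<Prod>i<d. (of_bool (x i = c i) - 1 / n) + 1 / n)"
    by (subst prod_of_bool[symmetric]) auto
  also have "\<dots> = (\<Sum>A\<in>Pow {..<d}. (1 / n) ^ card ({..<d} - A) * coord_dev n A c x)"
    by (subst prod_add) (auto simp: coord_dev_def mult.commute)
  finally show ?thesis .
qed

text \<open>The same expansion read backwards: a product of \<open>card A\<close> centred factors
  decays at \<open>card A\<close> times the rate of one, so damping factor by factor gives back a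
  product over coordinates.\<close>

lemma sum_decayed_coord_dev:
  "(\<Sum>A\<in>Pow {..<d}. (1 / real n) ^ card ({..<d} - A) * (exp (- (card A * (real n / (real n - 1))) * t) * coord_dev n A c x)) =
    (\<Prod>i<d. coord_kernel n t (x i) (c i))"
proof -
  have "(\<Prod>i<d. coord_kernel n t (x i) (c i)) =
      (\<Prod>i<d. exp (- (real n / (real n - 1)) * t) * (of_bool (x i = c i) - 1 / real n) + 1 / real n)"
    by (simp add: coord_kernel_def add.commute)
  also have "\<dots> = (\<Sum>A\<in>Pow {..<d}. (\<Prod>i\<in>A. exp (- (real n / (real n - 1)) * t) * (of_bool (x i = c i) - 1 / real n)) * (1 / real n) ^ card ({..<d} - A))"
    by (subst prod_add) auto
  also have "\<dots> = (\<Sum>A\<in>Pow {..<d}. (1 / real n) ^ card ({..<d} - A) * (exp (- (card A * (real n / (real n - 1))) * t) * coord_dev n A c x))"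
  proof (rule sum.cong[OF refl])
    fix A :: "nat set"
    have "(\<Prod>i\<in>A. exp (- (real n / (real n - 1)) * t)) = exp (- (card A * (real n / (real n - 1))) * t)"
      by (simp add: mult.assoc flip: exp_of_nat_mult)
    then show "(\<Prod>i\<in>A. exp (- (real n / (real n - 1)) * t) * (of_bool (x i = c i) - 1 / real n)) * (1 / real n) ^ card ({..<d} - A) =
        (1 / real n) ^ card ({..<d} - A) * (exp (- (card A * (real n / (real n - 1))) * t) * coord_dev n A c x)"
      by (simp only: prod.distrib coord_dev_def mult_ac)
  qed
  finally show ?thesis by simp
qed

text \<open>The kernel is symmetric, so the uniform law is stationary.\<close>

lemma sum_uniform_kernel:
  assumes n: "n \<ge> 2" and c: "c \<in> vertices n d"
  shows "(\<Sum>y\<in>vertices n d. pmf (pmf_of_set (vertices n d)) y * (\<Prod>i<d. coord_kernel n t (y i) (c i))) = equilibrium n d"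
proof -
  have ne: "vertices n d \<noteq> {}" using c by auto
  have "(\<Sum>y\<in>vertices n d. \<Prod>i<d. coord_kernel n t (y i) (c i)) = (\<Prod>i<d. \<Sum>a<n. coord_kernel n t a (c i))"
    unfolding vertices_def by (rule prod_sum_PiE[symmetric]) auto
  also have "\<dots> = (\<Prod>i<d. \<Sum>a<n. coord_kernel n t (c i) a)"
    by (simp add: coord_kernel_def eq_commute)
  also have "\<dots> = 1"
    using n coordinate_in_vertices[OF c] by (simp add: sum_kernel)
  finally show ?thesis
    using ne by (simp add: equilibrium_def card_vertices flip: sum_divide_distrib)
qed

lemma origin_in_vertices: "n \<ge> 2 \<Longrightarrow> origin d \<in> vertices n d"
  by (auto simp: origin_def vertices_def)

lemma sum_return_origin:
  assumes "n \<ge> 2"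
  shows "(\<Sum>y\<in>vertices n d. pmf (return_pmf (origin d)) y * (\<Prod>i<d. coord_kernel n t (y i) (c i))) =
    (\<Prod>i<d. coord_kernel n t 0 (c i))"
proof -
  have "(\<Sum>y\<in>vertices n d. pmf (return_pmf (origin d)) y * (\<Prod>i<d. coord_kernel n t (y i) (c i))) =
      (\<Sum>y\<in>vertices n d. if y = origin d then (\<Prod>i<d. coord_kernel n t (y i) (c i)) else 0)"
    by (intro sum.cong) (auto simp: indicator_def)
  then show ?thesis
    using origin_in_vertices[OF assms] by (simp add: sum.delta) (simp add: origin_def)
qed

lemma maximal_walk_coupling_time_le:
  assumes n: "n \<ge> 2" and d: "d \<ge> 1"
    and coupling: "is_coupling n d (return_pmf (origin d)) (pmf_of_set (vertices n d)) M X Y"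
    and maximal: "is_maximal M (vertices n d) X Y"
  shows "(\<integral>\<^sup>+\<omega>. coupling_time X Y \<omega> \<partial>M) \<le> ennreal (mixing_time n d + 2 * tail_const n)"
proof (rule maximal_coupling_time_le[OF n d _ _ _ _ maximal])
  have X: "random_walk n d (return_pmf (origin d)) M X"
    and Y: "random_walk n d (pmf_of_set (vertices n d)) M Y"
    using coupling by (auto simp: is_coupling_def)
  show "process M (vertices n d) X" "process M (vertices n d) Y"
    using X Y by (auto simp: random_walk_def)
  fix t :: real and x assume t: "t \<ge> 0" and x: "x \<in> vertices n d"
  show "measure M {\<omega> \<in> space M. X t \<omega> = x} = (\<Prod>i<d. coord_kernel n t 0 (x i))"
    unfolding random_walk_law[OF X n d t x] by (rule sum_return_origin[OF n])
  show "measure M {\<omega> \<in> space M. Y t \<omega> = x} = equilibrium n d"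
    unfolding random_walk_law[OF Y n d t x] by (rule sum_uniform_kernel[OF n x])
qed

text \<open>State indicators expand into eigenfunctions whose means decay exponentially, so the
  rates alone determine these laws. The proof treats both components at once, with
  \<open>\<pi>\<close> for either projection.\<close>

lemma hat_law:
  assumes Z: "markov_jump M (vertices n d \<times> vertices n d) (hat_rate n d) \<mu> (\<lambda>t \<omega>. (X t \<omega>, Y t \<omega>)) p"
    and n: "n \<ge> 2" and t: "t \<ge> 0" and c: "c \<in> vertices n d"
  shows "measure M {\<omega> \<in> space M. X t \<omega> = c} =
      (\<Sum>z\<in>vertices n d \<times> vertices n d. pmf \<mu> z * (\<Prod>i<d. coord_kernel n t (fst z i) (c i)))" (is ?fst)
    and "measure M {\<omega> \<in> space M. Y t \<omega> = c} =
      (\<Sum>z\<in>vertices n d \<times> vertices n d. pmf \<mu> z * (\<Prod>i<d. coord_kernel n t (snd z i) (c i)))" (is ?snd)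
proof -
  interpret markov_jump M "vertices n d \<times> vertices n d" "hat_rate n d" \<mu> "\<lambda>t \<omega>. (X t \<omega>, Y t \<omega>)" p
    by (rule Z)
  let ?S = "vertices n d \<times> vertices n d"
  have c_less: "c i < n" if "i < d" for i
    using c that by (rule coordinate_in_vertices)
  have law: "prob {\<omega> \<in> space M. \<pi> (X t \<omega>, Y t \<omega>) = c} =
      (\<Sum>z\<in>?S. pmf \<mu> z * (\<Prod>i<d. coord_kernel n t (\<pi> z i) (c i)))"
    if \<pi>: "\<And>z. z \<in> ?S \<Longrightarrow> \<pi> z \<in> vertices n d"
      and eigen: "\<And>A z. A \<subseteq> {..<d} \<Longrightarrow> z \<in> ?S \<Longrightarrow>
        gen (\<lambda>z. coord_dev n A c (\<pi> z)) z = - (card A * (n / (real n - 1))) * coord_dev n A c (\<pi> z)" for \<pi>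
  proof -
    let ?w = "\<lambda>A. (1 / n) ^ card ({..<d} - A) :: real"
    have "prob {\<omega> \<in> space M. \<pi> (X t \<omega>, Y t \<omega>) = c} = expect t (\<lambda>z. of_bool (\<pi> z = c))"
      by (rule expect_indicator[OF t, symmetric])
    also have "\<dots> = expect t (\<lambda>z. \<Sum>A\<in>Pow {..<d}. ?w A * coord_dev n A c (\<pi> z))"
      unfolding expect_def using of_bool_eq_sum_coord_dev[OF \<pi> c] by (intro sum.cong) auto
    also have "\<dots> = (\<Sum>A\<in>Pow {..<d}. ?w A * expect t (\<lambda>z. coord_dev n A c (\<pi> z)))"
      by (rule expect_sum)
    also have "\<dots> = (\<Sum>A\<in>Pow {..<d}. ?w A * (exp (- (card A * (n / (real n - 1))) * t) * expect 0 (\<lambda>z. coord_dev n A c (\<pi> z))))"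
      using n by (intro sum.cong refl arg_cong2[where f = "(*)"] expect_eigenfunction eigen t) auto
    also have "\<dots> = (\<Sum>A\<in>Pow {..<d}. \<Sum>z\<in>?S. pmf \<mu> z * (?w A * (exp (- (card A * (n / (real n - 1))) * t) * coord_dev n A c (\<pi> z))))"
      by (simp add: expect_def initial sum_distrib_left mult_ac)
    also have "\<dots> = (\<Sum>z\<in>?S. pmf \<mu> z * (\<Sum>A\<in>Pow {..<d}. ?w A * (exp (- (card A * (n / (real n - 1))) * t) * coord_dev n A c (\<pi> z))))"
      by (subst sum.swap) (simp only: sum_distrib_left)
    finally show ?thesis
      by (simp only: sum_decayed_coord_dev)
  qed
  show ?fst
    using law[of fst] hat_gen_coord_dev(1)[where c = c, OF n _ c_less] by (auto simp: gen_def)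
  show ?snd
    using law[of snd] hat_gen_coord_dev(2)[where c = c, OF n _ c_less] by (auto simp: gen_def)
qed

lemma pmf_initial:
  "pmf (map_pmf (\<lambda>y. (a, y)) \<nu>) (x, y) = of_bool (x = a) * pmf \<nu> y"
proof (cases "x = a")
  case True
  then show ?thesis
    using pmf_map_inj'[of "\<lambda>y. (a, y)" \<nu> y] by (simp add: inj_on_def)
next
  case False
  then show ?thesis
    by (auto simp: pmf_eq_0_set_pmf)
qed

lemma sum_initial:
  assumes "finite V" "a \<in> V"
  shows "(\<Sum>z\<in>V \<times> V. pmf (map_pmf (\<lambda>y. (a, y)) \<nu>) z * F z) = (\<Sum>y\<in>V. pmf \<nu> y * F (a, y))"
proof -
  have "(\<Sum>z\<in>V \<times> V. pmf (map_pmf (\<lambda>y. (a, y)) \<nu>) z * F z) =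
      (\<Sum>x\<in>V. if x = a then \<Sum>y\<in>V. pmf \<nu> y * F (a, y) else 0)"
    by (subst sum.cartesian_product') (auto simp: pmf_initial intro!: sum.cong)
  then show ?thesis
    using assms by (simp add: sum.delta)
qed

text \<open>Maximality compares with the distance between the laws of this very coupling, so
  \<open>hat_law\<close> takes the place that \<open>random_walk_law\<close> has for couplings of
  random walks.\<close>

lemma hat_maximal_coupling_time_le:
  assumes n: "n \<ge> 2" and d: "d \<ge> 1" and hat: "hat_coupling n d M X Y"
    and maximal: "is_maximal M (vertices n d) X Y"
  shows "(\<integral>\<^sup>+\<omega>. coupling_time X Y \<omega> \<partial>M) \<le> ennreal (mixing_time n d + 2 * tail_const n)"
proof -
  let ?\<mu> = "map_pmf (\<lambda>y. (origin d, y)) (pmf_of_set (vertices n d))"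
  obtain p where Z: "markov_jump M (vertices n d \<times> vertices n d) (hat_rate n d) ?\<mu> (\<lambda>t \<omega>. (X t \<omega>, Y t \<omega>)) p"
    by (rule hat_couplingD[OF hat])
  have process: "process M (vertices n d) X" "process M (vertices n d) Y"
    using process_fst_snd[OF markov_jump.process_Z[OF Z]] by auto
  note origin = origin_in_vertices[OF n, of d]
  have ne: "vertices n d \<noteq> {}" using origin by auto
  have sum_1: "(\<Sum>y\<in>vertices n d. pmf (pmf_of_set (vertices n d)) y) = 1"
    using ne by (intro sum_pmf_eq_1) auto
  show ?thesis
  proof (rule maximal_coupling_time_le[OF n d process _ _ maximal])
    fix t :: real and x assume t: "t \<ge> 0" and x: "x \<in> vertices n d"
    show "measure M {\<omega> \<in> space M. X t \<omega> = x} = (\<Prod>i<d. coord_kernel n t 0 (x i))"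
      using sum_1 unfolding hat_law(1)[OF Z n t x] sum_initial[OF finite_vertices origin]
      by (simp add: origin_def flip: sum_distrib_right)
    show "measure M {\<omega> \<in> space M. Y t \<omega> = x} = equilibrium n d"
      unfolding hat_law(2)[OF Z n t x] sum_initial[OF finite_vertices origin]
      using sum_uniform_kernel[OF n x] by simp
  qed
qed

section \<open>Initial mean of the merging bound\<close>

text \<open>Divided by \<open>n ^ d\<close> this is the generating function of the binomial number
  of initially unmatched coordinates: one value per coordinate agrees with the origin and
  \<open>n - 1\<close> differ.\<close>

lemma sum_power_unmatched:
  fixes s :: real
  assumes "n \<ge> 2"
  shows "(\<Sum>y\<in>vertices n d. s ^ card (unmatched d (origin d) y)) = (1 + (real n - 1) * s) ^ d"
proof -
  have "s ^ card (unmatched d (origin d) y) = (\<Prod>i<d. if y i = 0 then 1 else s)" for y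
  proof -
    have "(\<Prod>i<d. if y i = 0 then 1 else s) = (\<Prod>i\<in>unmatched d (origin d) y. s)"
      by (rule prod.mono_neutral_cong_right) (auto simp: unmatched_def origin_def)
    then show ?thesis by simp
  qed
  then have "(\<Sum>y\<in>vertices n d. s ^ card (unmatched d (origin d) y)) = (\<Prod>i<d. \<Sum>a<n. if a = 0 then 1 else s)"
    unfolding vertices_def by (simp only:) (rule prod_sum_PiE[symmetric], auto)
  also have "(\<Sum>a<n. if a = 0 then 1 else s) = 1 + (real n - 1) * s"
    using assms by (cases n) (simp_all add: sum.lessThan_Suc_shift del: sum.lessThan_Suc)
  finally show ?thesis by simp
qed

text \<open>\<open>ln 8\<close> comes from comparing \<open>N\<close> with \<open>d / 8\<close>; the
  term with \<open>(4 / 5) ^ d\<close> is a Chernoff-type bound for starting points with fewer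
  unmatched coordinates. Both are negligible against \<open>ln d\<close>.\<close>

definition merging_lower :: "nat \<Rightarrow> nat \<Rightarrow> real" where
  "merging_lower n d = (real n - 1) / n * (ln d - ln 8 - 1 - ln d * (4 / 5) ^ d)"

lemma merging_bound_nonneg: "n \<ge> 2 \<Longrightarrow> merging_bound n N \<ge> 0"
proof -
  assume n: "n \<ge> 2"
  have "harm 1 \<le> (harm (Suc N) :: real)"
    by (rule harm_mono) simp
  moreover have "harm 1 = (1 :: real)"
    by (simp add: harm_def)
  ultimately show ?thesis
    using n by (simp add: merging_bound_def)
qed

text \<open>The factor \<open>(3/4) ^ 8\<close> makes the error term at least \<open>ln d\<close> when \<open>8 * N \<le> d\<close>, while its mean over
  the uniform starting point is small, by \<open>sum_power_unmatched\<close>.\<close>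

lemma merging_bound_ge:
  assumes n: "n \<ge> 2" and d: "d \<ge> 1"
  shows "merging_bound n N \<ge>
    (real n - 1) / n * (ln d - ln 8 - 1 - ln d * ((3 / 4) ^ 8) ^ N * (4 / 3) ^ d)"
proof -
  have "ln d - ln 8 - 1 - ln d * ((3 / 4) ^ 8) ^ N * (4 / 3) ^ d \<le> harm (Suc N) - (1 :: real)"
  proof (cases "8 * N \<le> d")
    case True
    have "(3 / 4 :: real) ^ d \<le> (3 / 4) ^ (8 * N)"
      using True by (intro power_decreasing) auto
    then have "(3 / 4) ^ d * (4 / 3) ^ d \<le> ((3 / 4) ^ 8) ^ N * (4 / 3 :: real) ^ d"
      by (intro mult_right_mono) (simp_all add: power_mult)
    also have "(3 / 4) ^ d * (4 / 3) ^ d = (1 :: real)"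
      by (simp flip: power_mult_distrib)
    finally have "ln d * 1 \<le> ln d * (((3 / 4) ^ 8) ^ N * (4 / 3 :: real) ^ d)"
      using d by (intro mult_left_mono) auto
    moreover have "harm (Suc N) \<ge> (0 :: real)"
      by (rule harm_nonneg)
    moreover have "ln (8 :: real) \<ge> 0" by simp
    ultimately show ?thesis by (simp only: mult.assoc)
  next
    case False
    have "ln (d / 8) \<le> ln (real (Suc N) + 1)"
      using False d by (intro ln_mono) auto
    also have "\<dots> \<le> harm (Suc N)"
      by (rule ln_le_harm)
    finally have "ln d - ln 8 \<le> harm (Suc N)"
      using d by (simp add: ln_div)
    moreover have "0 \<le> ln d * ((3 / 4) ^ 8) ^ N * (4 / 3 :: real) ^ d"
      using d by simp
    ultimately show ?thesis by linarith
  qed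
  then show ?thesis
    unfolding merging_bound_def using n by (intro mult_left_mono) auto
qed

lemma expected_merging_bound_ge:
  assumes n: "n \<ge> 2" and d: "d \<ge> 1"
  shows "merging_lower n d \<le>
    (\<Sum>y\<in>vertices n d. pmf (pmf_of_set (vertices n d)) y * merging_bound n (card (unmatched d (origin d) y)))"
proof -
  define V where "V = vertices n d"
  define s :: real where "s = (3 / 4) ^ 8"
  define U where "U y = card (unmatched d (origin d) y)" for y
  define c where "c = (real n - 1) / n"
  have V: "finite V" "card V = n ^ d" "V \<noteq> {}"
    using origin_in_vertices[OF n, of d] by (auto simp: V_def card_vertices)
  have pmf: "pmf (pmf_of_set V) y = 1 / n ^ d" if "y \<in> V" for y
    using V that by simp
  \<comment> \<open>\<open>s\<close> is below \<open>1 / 5\<close>, and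
    \<open>1 + (n - 1) / 5 \<le> 3 / 5 * n\<close> for \<open>n \<ge> 2\<close>, with equality at 2.
    Multiplying \<open>3 / 5\<close> by \<open>4 / 3\<close> gives the base
    \<open>4 / 5\<close>.\<close>
  have "(1 + (real n - 1) * s) / n \<le> 3 / 5"
  proof -
    have "1 + (real n - 1) * s \<le> 1 + (real n - 1) * (1 / 5)"
      using n by (intro add_left_mono mult_left_mono) (auto simp: s_def power_divide)
    also have "\<dots> \<le> 3 / 5 * n"
      using n by (simp add: field_simps)
    finally show ?thesis
      using n by (simp add: field_simps)
  qed
  then have "((1 + (real n - 1) * s) / n) ^ d * (4 / 3) ^ d \<le> (3 / 5) ^ d * (4 / 3) ^ d"
    using n by (intro mult_right_mono power_mono) (auto simp: s_def)
  also have "\<dots> = (4 / 5) ^ d"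
    by (simp flip: power_mult_distrib)
  finally have power: "((1 + (real n - 1) * s) / n) ^ d * (4 / 3) ^ d \<le> (4 / 5) ^ d" .
  have mean: "(\<Sum>y\<in>V. pmf (pmf_of_set V) y * s ^ U y) = ((1 + (real n - 1) * s) / n) ^ d"
    using sum_power_unmatched[OF n, where d = d and s = s]
    by (simp add: pmf U_def V_def[symmetric] power_divide flip: sum_divide_distrib)
  have "merging_lower n d \<le> c * (ln d - ln 8 - 1) - c * ln d * (((1 + (real n - 1) * s) / n) ^ d * (4 / 3) ^ d)"
    using mult_left_mono[OF power, of "c * ln d"] n d
    by (simp add: merging_lower_def c_def[symmetric] right_diff_distrib)
       (simp add: c_def mult_ac)
  also have "\<dots> = (\<Sum>y\<in>V. pmf (pmf_of_set V) y * (c * (ln d - ln 8 - 1 - ln d * s ^ U y * (4 / 3) ^ d)))"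
  proof -
    have "(\<Sum>y\<in>V. pmf (pmf_of_set V) y * (c * (ln d - ln 8 - 1 - ln d * s ^ U y * (4 / 3) ^ d))) =
        (\<Sum>y\<in>V. pmf (pmf_of_set V) y) * (c * (ln d - ln 8 - 1)) - (\<Sum>y\<in>V. pmf (pmf_of_set V) y * s ^ U y) * (c * ln d * (4 / 3) ^ d)"
      unfolding sum_distrib_right sum_subtractf[symmetric] by (intro sum.cong) (auto simp: algebra_simps)
    moreover have "(\<Sum>y\<in>V. pmf (pmf_of_set V) y) = 1"
      using V by (intro sum_pmf_eq_1) auto
    ultimately show ?thesis
      unfolding mean by (simp add: mult_ac)
  qed
  also have "\<dots> \<le> (\<Sum>y\<in>V. pmf (pmf_of_set V) y * merging_bound n (U y))"
    unfolding c_def s_def by (intro sum_mono mult_left_mono merging_bound_ge[OF n d]) auto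
  finally show ?thesis
    by (simp add: V_def U_def)
qed

lemma hat_coupling_time_ge:
  assumes n: "n \<ge> 2" and d: "d \<ge> 1" and hat: "hat_coupling n d M X Y"
  shows "ennreal (merging_lower n d) \<le> (\<integral>\<^sup>+\<omega>. coupling_time X Y \<omega> \<partial>M)"
proof -
  let ?\<mu> = "map_pmf (\<lambda>y. (origin d, y)) (pmf_of_set (vertices n d))"
  obtain p where Z: "markov_jump M (vertices n d \<times> vertices n d) (hat_rate n d) ?\<mu> (\<lambda>t \<omega>. (X t \<omega>, Y t \<omega>)) p"
    by (rule hat_couplingD[OF hat])
  define F where "F z = merging_bound n (card (unmatched d (fst z) (snd z)))" for z
  have "ennreal (merging_lower n d) \<le> ennreal (\<Sum>z\<in>vertices n d \<times> vertices n d. pmf ?\<mu> z * F z)"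
    using expected_merging_bound_ge[OF n d] sum_initial[OF finite_vertices origin_in_vertices[OF n, of d], where F = F]
    by (intro ennreal_leI) (simp add: F_def)
  also have "\<dots> \<le> (\<integral>\<^sup>+\<omega>. coupling_time X Y \<omega> \<partial>M)"
  proof (rule coupling_time_ge[OF Z])
    show "F z \<ge> 0" for z
      unfolding F_def by (rule merging_bound_nonneg[OF n])
    show "F (x, x) = 0" for x
      by (simp add: F_def merging_bound_def unmatched_def harm_def)
    show "markov_jump.gen (vertices n d \<times> vertices n d) (hat_rate n d) F (x, y) \<ge> - 1"
      if "(x, y) \<in> vertices n d \<times> vertices n d" "x \<noteq> y" for x y
      using hat_gen_merging_bound[OF n _ _ that(2)] that(1)
      unfolding markov_jump.gen_def[OF Z] F_def by auto
  qed
  finally show ?thesis .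
qed

section \<open>Comparison of the two bounds as the dimension grows\<close>

lemma inverse_antimono_ennreal:
  fixes a b :: ennreal
  assumes "a \<le> b"
  shows "inverse b \<le> inverse a"
proof (cases a)
  case a: (real r)
  show ?thesis
  proof (cases b)
    case b: (real s)
    show ?thesis
    proof (cases "r = 0")
      case False
      then have "0 < r" "0 < s" "r \<le> s"
        using a b assms by (auto simp: ennreal_le_iff)
      then show ?thesis
        using a b by (simp add: inverse_ennreal ennreal_leI le_imp_inverse_le)
    qed (simp add: a)
  qed simp
qed (use assms in \<open>simp add: top_unique\<close>)

theorem mainTheorem2:
  fixes n :: nat
    and M :: "nat \<Rightarrow> 'w measure"
    and X Y :: "nat \<Rightarrow> real \<Rightarrow> 'w \<Rightarrow> nat \<Rightarrow> nat"
  assumes "n \<ge> 2"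
    and "\<And>d. d \<ge> 1 \<Longrightarrow> hat_coupling n d (M d) (X d) (Y d)"
  shows "(\<forall>(M' :: nat \<Rightarrow> 'v measure) X' Y'.
            (\<forall>d\<ge>1. is_coupling n d (return_pmf (origin d)) (pmf_of_set (vertices n d))
                      (M' d) (X' d) (Y' d) \<and>
                    is_maximal (M' d) (vertices n d) (X' d) (Y' d)) \<longrightarrow>
            liminf (\<lambda>d. (\<integral>\<^sup>+\<omega>. coupling_time (X d) (Y d) \<omega> \<partial>M d) /
                        (\<integral>\<^sup>+\<omega>. coupling_time (X' d) (Y' d) \<omega> \<partial>M' d))
              \<ge> ennreal (real n / (real n - 1))) \<and>
         (\<forall>\<^sub>F d in sequentially. \<not> is_maximal (M d) (vertices n d) (X d) (Y d))"
proof (intro conjI allI impI)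
  note n = assms(1) and hat = assms(2)
  define K where "K = 2 * tail_const n"
  have K: "K \<ge> 0" using n by (simp add: K_def tail_const_def)
  define c where "c = (real n - 1) / n"
  have c: "c > 0" using n by (simp add: c_def)
  have lower: "merging_lower n d = c * (ln d - ln 8 - 1 - ln d * (4 / 5) ^ d)" for d
    by (simp add: merging_lower_def c_def)
  have upper: "mixing_time n d = c / 2 * ln d" for d
    by (simp add: mixing_time_def c_def)
  have ratio: "(\<lambda>d. merging_lower n d / (mixing_time n d + K)) \<longlonglongrightarrow> 2"
    unfolding lower upper using c K by real_asymp
  show "liminf (\<lambda>d. (\<integral>\<^sup>+\<omega>. coupling_time (X d) (Y d) \<omega> \<partial>M d) /
                    (\<integral>\<^sup>+\<omega>. coupling_time (X' d) (Y' d) \<omega> \<partial>M' d)) \<ge> ennreal (real n / (real n - 1))"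
    if *: "\<forall>d\<ge>1. is_coupling n d (return_pmf (origin d)) (pmf_of_set (vertices n d)) (M' d) (X' d) (Y' d) \<and>
        is_maximal (M' d) (vertices n d) (X' d) (Y' d)" for M' :: "nat \<Rightarrow> 'v measure" and X' Y'
  proof -
    have "ennreal (real n / (real n - 1)) \<le> ennreal 2"
      using n by (intro ennreal_leI) (simp add: field_simps)
    also have "\<dots> = liminf (\<lambda>d. ennreal (merging_lower n d / (mixing_time n d + K)))"
      using ratio by (intro lim_imp_Liminf[symmetric] tendsto_ennrealI) auto
    also have "\<dots> \<le> liminf (\<lambda>d. (\<integral>\<^sup>+\<omega>. coupling_time (X d) (Y d) \<omega> \<partial>M d) /
                    (\<integral>\<^sup>+\<omega>. coupling_time (X' d) (Y' d) \<omega> \<partial>M' d))"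
    proof (rule Liminf_mono)
      show "\<forall>\<^sub>F d in sequentially. ennreal (merging_lower n d / (mixing_time n d + K)) \<le>
          (\<integral>\<^sup>+\<omega>. coupling_time (X d) (Y d) \<omega> \<partial>M d) / (\<integral>\<^sup>+\<omega>. coupling_time (X' d) (Y' d) \<omega> \<partial>M' d)"
        using eventually_ge_at_top[of 2]
      proof eventually_elim
        case (elim d)
        then have d: "d \<ge> 1" by simp
        have pos: "mixing_time n d + K > 0"
          using c K elim by (auto simp: upper intro!: add_pos_nonneg)
        \<comment> \<open>For small \<open>d\<close> the lower bound may be negative;
          \<open>ennreal\<close> then truncates it to 0.\<close>
        have "ennreal (merging_lower n d / (mixing_time n d + K)) \<le>
            ennreal (merging_lower n d) / ennreal (mixing_time n d + K)"
        proof (cases "merging_lower n d \<ge> 0")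
          case True
          then show ?thesis using pos by (simp add: divide_ennreal)
        next
          case False
          then show ?thesis using pos by (simp add: ennreal_neg divide_nonpos_pos)
        qed
        also have "\<dots> \<le> (\<integral>\<^sup>+\<omega>. coupling_time (X d) (Y d) \<omega> \<partial>M d) / ennreal (mixing_time n d + K)"
          using hat_coupling_time_ge[OF n d hat[OF d]] by (rule divide_right_mono_ennreal)
        also have "\<dots> \<le> (\<integral>\<^sup>+\<omega>. coupling_time (X d) (Y d) \<omega> \<partial>M d) / (\<integral>\<^sup>+\<omega>. coupling_time (X' d) (Y' d) \<omega> \<partial>M' d)"
          unfolding divide_ennreal_def K_def
          using * d by (intro mult_left_mono inverse_antimono_ennreal maximal_walk_coupling_time_le[OF n d]) auto
        finally show ?case .
      qed
    qed
    finally show ?thesis .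
  qed
  \<comment> \<open>A limit above 1 suffices for the last claim: under maximality the q-hat coupling
    would obey the upper bound as well as its own lower bound.\<close>
  have "\<forall>\<^sub>F d :: nat in sequentially. merging_lower n d / (mixing_time n d + K) > 1"
    using ratio by (rule order_tendstoD) simp
  then show "\<forall>\<^sub>F d in sequentially. \<not> is_maximal (M d) (vertices n d) (X d) (Y d)"
    using eventually_ge_at_top[of 2]
  proof eventually_elim
    case (elim d)
    then have d: "d \<ge> 1" by simp
    have pos: "mixing_time n d + K > 0"
      using c K elim by (auto simp: upper intro!: add_pos_nonneg)
    show ?case
    proof
      assume "is_maximal (M d) (vertices n d) (X d) (Y d)"
      from hat_coupling_time_ge[OF n d hat[OF d]] hat_maximal_coupling_time_le[OF n d hat[OF d] this]
      have "ennreal (merging_lower n d) \<le> ennreal (mixing_time n d + K)"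
        unfolding K_def by (rule order_trans)
      then show False
        using elim pos by (simp add: ennreal_le_iff)
    qed
  qed
qed

end
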